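(* Let $A \in \mathbb{Z}^{m\times n}$ with $\operatorname{rank}(A)=m\ge 1$, $b\in\mathbb{Z}^m$, $c\in\mathbb{Z}^n$, and assume $\max\{c^\top z : Az=b,\ z\in\mathbb{Z}^n_{\ge 0}\}$ is feasible and bounded. Let $B$ be an $m\times m$ submatrix of $A$ satisfying \[ \Delta \le |\det(B)|\cdot (2\log(m+1))^{m/2}, \] and let $U\in\mathbb{Z}^{m\times m}$ be a unimodular matrix (i.e. $|\det U|=1$) such that $UB$ is upper triangular. Consider ($U$-IP) $\max\{c^\top z : UAz=Ub,\ z\in\mathbb{Z}^n_{\ge 0}\}$ and its linear relaxation ($U$-LP) $\max\{c^\top x : UAx=Ub,\ x\in\mathbb{R}^n_{\ge 0}\}$. Then for every optimal vertex solution $x^*$ of ($U$-LP) there exists an optimal solution $z^*$ of ($U$-IP) satisfying \[ \|z^*-x^*\|_1 < 3m^2\log\Bigl(2\sqrt{2m\log(m+1)}\cdot \|UB\|_\infty\Bigr)\cdot (2\log(m+1))^{m/2}\cdot \|UB\|_\infty^m . \]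
   Context: $\Delta:=\Delta_m(A)$ is the largest absolute value of the determinant of an $m\times m$ submatrix of $A$. $\|M\|_\infty$ for a matrix $M$ denotes the largest absolute value of an entry of $M$. All logarithms $\log$ are base 2. *)

theory Defs
  imports "Jordan_Normal_Form.DL_Rank" "Jordan_Normal_Form.DL_Submatrix" "Jordan_Normal_Form.Determinant"
begin

definition Delta :: "int mat \<Rightarrow> int" where
  "Delta A = Max {\<bar>det (submatrix A UNIV J)\<bar> | J. J \<subseteq> {..<dim_col A} \<and> card J = dim_row A}"

definition max_abs_entry :: "int mat \<Rightarrow> int" where
  "max_abs_entry M = Max {\<bar>M $$ (i, j)\<bar> | i j. i < dim_row M \<and> j < dim_col M}"

definition ip_feasible :: "int mat \<Rightarrow> int vec \<Rightarrow> int vec \<Rightarrow> bool" where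
  "ip_feasible A b z \<longleftrightarrow> z \<in> carrier_vec (dim_col A) \<and> (\<forall>i < dim_col A. z $ i \<ge> 0) \<and> A *\<^sub>v z = b"

definition ip_optimal :: "int mat \<Rightarrow> int vec \<Rightarrow> int vec \<Rightarrow> int vec \<Rightarrow> bool" where
  "ip_optimal A b c z \<longleftrightarrow> ip_feasible A b z \<and> (\<forall>z'. ip_feasible A b z' \<longrightarrow> c \<bullet> z' \<le> c \<bullet> z)"

definition lp_feasible :: "int mat \<Rightarrow> int vec \<Rightarrow> real vec \<Rightarrow> bool" where
  "lp_feasible A b x \<longleftrightarrow> x \<in> carrier_vec (dim_col A) \<and> (\<forall>i < dim_col A. x $ i \<ge> 0)
     \<and> map_mat real_of_int A *\<^sub>v x = map_vec real_of_int b"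

definition lp_vertex :: "int mat \<Rightarrow> int vec \<Rightarrow> real vec \<Rightarrow> bool" where
  "lp_vertex A b x \<longleftrightarrow> lp_feasible A b x \<and>
     (\<forall>y w t. lp_feasible A b y \<and> lp_feasible A b w \<and> 0 < t \<and> t < 1
        \<and> x = t \<cdot>\<^sub>v y + (1 - t) \<cdot>\<^sub>v w \<longrightarrow> y = w)"

definition lp_optimal :: "int mat \<Rightarrow> int vec \<Rightarrow> int vec \<Rightarrow> real vec \<Rightarrow> bool" where
  "lp_optimal A b c x \<longleftrightarrow> lp_feasible A b x \<and>
     (\<forall>y. lp_feasible A b y \<longrightarrow> map_vec real_of_int c \<bullet> y \<le> map_vec real_of_int c \<bullet> x)"

end

theory Submission
  imports Defs
begin

text \<open>
  Since \<open>U\<close> is unimodular, the transformed programs have the same feasible points as the original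
  ones, and it suffices to bound the distance by \<open>3 m\<^sup>2 log(2 \<surd>m \<Delta>\<^sup>1\<^sup>/\<^sup>m) \<Delta>\<close>: the determinant of the
  triangular matrix \<open>UB\<close> is at most \<open>\<parallel>UB\<parallel>\<^sup>m\<close>.

  Let \<open>z\<close> be an integer optimum of minimal support size \<open>s\<close>. Then \<open>z - x\<^sup>*\<close> is a conformal sum of at
  most \<open>s\<close> nonnegative multiples of integer kernel vectors whose entries are \<open>m \<times> m\<close> minors and whose
  support has at most \<open>m + 1\<close> elements; rounding the multipliers down and subtracting from \<open>z\<close> leaves an
  integer optimum at distance less than \<open>s (m + 1) \<Delta>\<close>.

  It remains to bound \<open>s\<close>. By minimality the \<open>2\<^sup>s\<close> subset sums of the columns in the support are
  distinct integer points. In the coordinates of a basis of maximal determinant all columns have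
  entries in \<open>[-1, 1]\<close>, so a random subset sum deviates by at most \<open>\<surd>s / 2\<close> from its mean in each
  coordinate on average. Giving each integer point a weight that decays exponentially with this
  deviation, the total weight of the subset sums is at least \<open>e\<^sup>-\<^sup>m 2\<^sup>s\<close>, whereas that of all integer
  points is at most \<open>\<Delta> (1 + s)\<^sup>m\<^sup>/\<^sup>2\<close>. For \<open>m = 1\<close> counting integers in an interval gives more.
\<close>

section \<open>Minors\<close>

text \<open>Columns are listed by a function instead of a set, so that Cramer's rule can exchange a
  single column by writing \<open>f(k := j)\<close>; any order and repetitions are therefore
  allowed.\<close>

definition col_select :: "int mat \<Rightarrow> (nat \<Rightarrow> nat) \<Rightarrow> int mat" where
  "col_select A f = mat (dim_row A) (dim_row A) (\<lambda>(i, k). A $$ (i, f k))"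

lemma col_select_carrier [simp]: "A \<in> carrier_mat m n \<Longrightarrow> col_select A f \<in> carrier_mat m m"
  by (auto simp: col_select_def)

lemma col_select_index [simp]:
  "A \<in> carrier_mat m n \<Longrightarrow> i < m \<Longrightarrow> k < m \<Longrightarrow> col_select A f $$ (i, k) = A $$ (i, f k)"
  by (auto simp: col_select_def)

lemma submatrix_eq_col_select:
  assumes "A \<in> carrier_mat m n" "J \<subseteq> {..<n}" "card J = m"
  shows "submatrix A UNIV J = col_select A (pick J)"
proof -
  have "{j. j < n \<and> j \<in> J} = J" using assms by auto
  then show ?thesis
    using assms by (auto simp: submatrix_def col_select_def pick_UNIV intro!: eq_matI)
qed

lemma bij_betw_pick:
  assumes "finite J" "card J = m"
  shows "bij_betw (pick J) {..<m} J"
proof -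
  have inj: "inj_on (pick J) {..<m}"
    using assms by (intro inj_onI) (metis card_pick lessThan_iff)
  moreover have "pick J ` {..<m} \<subseteq> J"
    using assms by (auto intro: pick_in_set)
  ultimately show ?thesis
    using assms by (simp add: bij_betw_def card_image card_subset_eq)
qed

lemma Delta_set_finite: "finite {\<bar>det (submatrix A UNIV J)\<bar> | J. J \<subseteq> {..<dim_col A} \<and> card J = dim_row A}"
proof -
  have "{\<bar>det (submatrix A UNIV J)\<bar> | J. J \<subseteq> {..<dim_col A} \<and> card J = dim_row A}
     = (\<lambda>J. \<bar>det (submatrix A UNIV J)\<bar>) ` {J. J \<subseteq> {..<dim_col A} \<and> card J = dim_row A}" by auto
  also have "finite \<dots>"
    by (intro finite_imageI finite_subset[OF _ finite_Pow_iff[THEN iffD2, of "{..<dim_col A}"]]) auto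
  finally show ?thesis .
qed

lemma abs_det_submatrix_le_Delta:
  assumes "A \<in> carrier_mat m n" "J \<subseteq> {..<n}" "card J = m"
  shows "\<bar>det (submatrix A UNIV J)\<bar> \<le> Delta A"
  unfolding Delta_def by (rule Max_ge[OF Delta_set_finite]) (use assms in auto)

lemma Delta_attained:
  assumes "A \<in> carrier_mat m n" "m \<le> n"
  obtains J where "J \<subseteq> {..<n}" "card J = m" "\<bar>det (submatrix A UNIV J)\<bar> = Delta A"
proof -
  have "{..<m} \<subseteq> {..<n}" using assms by auto
  then have "{\<bar>det (submatrix A UNIV J)\<bar> | J. J \<subseteq> {..<dim_col A} \<and> card J = dim_row A} \<noteq> {}"
    using assms by (auto intro!: exI[of _ "{..<m}"])
  from Max_in[OF Delta_set_finite this] show ?thesis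
    using that assms by (auto simp: Delta_def)
qed

lemma det_permute_columns:
  assumes A: "(A :: 'a :: comm_ring_1 mat) \<in> carrier_mat m m" and p: "p permutes {0..<m}"
  shows "det (mat m m (\<lambda>(i, j). A $$ (i, p j))) = signof p * det A"
proof -
  have AT: "A\<^sup>T \<in> carrier_mat m m" using A by auto
  have pl: "p j < m" if "j < m" for j using permutes_in_image[OF p, of j] that by auto
  have "mat m m (\<lambda>(i, j). A $$ (i, p j)) = (mat m m (\<lambda>(i, j). A\<^sup>T $$ (p i, j)))\<^sup>T"
    using A pl by (intro eq_matI) auto
  then have "det (mat m m (\<lambda>(i, j). A $$ (i, p j))) = det (mat m m (\<lambda>(i, j). A\<^sup>T $$ (p i, j)))"
    by (simp add: det_transpose[of _ m])
  then show ?thesis using det_permute_rows[OF AT p] det_transpose[OF A] by simp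
qed

text \<open>A repeated column gives determinant zero. Otherwise the selection is a column
  permutation of the submatrix on its image, which changes at most the sign.\<close>

lemma abs_det_col_select_le_Delta:
  assumes A: "A \<in> carrier_mat m n" and mn: "m \<le> n" and f: "\<And>k. k < m \<Longrightarrow> f k < n"
  shows "\<bar>det (col_select A f)\<bar> \<le> Delta A"
proof (cases "inj_on f {..<m}")
  case False
  then obtain k l where kl: "k < m" "l < m" "k \<noteq> l" "f k = f l" by (auto simp: inj_on_def)
  have "det (col_select A f) = 0"
    by (rule det_identical_columns[OF col_select_carrier[OF A] kl(3,1,2)])
      (use kl A in \<open>auto simp: col_select_def\<close>)
  \<comment> \<open>\<open>Delta A\<close> is nonnegative because it is attained as an absolute
    value.\<close>
  moreover obtain J where "\<bar>det (submatrix A UNIV J)\<bar> = Delta A"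
    using Delta_attained[OF A mn] by metis
  ultimately show ?thesis by (metis abs_ge_zero abs_zero)
next
  case True
  define J where "J = f ` {..<m}"
  have J: "J \<subseteq> {..<n}" "card J = m" "finite J" using f True by (auto simp: J_def card_image)
  note bij = bij_betw_pick[OF J(3,2)]
  define p where "p k = (if k < m then inv_into {..<m} (pick J) (f k) else k)" for k
  have fb: "bij_betw f {..<m} J" using True by (simp add: J_def bij_betw_def)
  have "bij_betw (inv_into {..<m} (pick J) \<circ> f) {..<m} {..<m}"
    using bij_betw_trans[OF fb bij_betw_inv_into[OF bij]] .
  then have "bij_betw p {0..<m} {0..<m}"
    by (subst bij_betw_cong[where g = "inv_into {..<m} (pick J) \<circ> f"]) (auto simp: p_def atLeast0LessThan)
  then have p: "p permutes {0..<m}"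
    by (rule bij_imp_permutes) (simp add: p_def)
  have pf: "pick J (p k) = f k" "p k < m" if "k < m" for k
    using that bij fb permutes_in_image[OF p, of k]
    by (auto simp: p_def f_inv_into_f J_def bij_betw_def)
  have "col_select A f = mat m m (\<lambda>(i, k). col_select A (pick J) $$ (i, p k))"
    using A pf by (intro eq_matI) (auto simp: col_select_def)
  then have "det (col_select A f) = signof p * det (submatrix A UNIV J)"
    using det_permute_columns[OF col_select_carrier[OF A] p, of "pick J"]
    by (simp add: submatrix_eq_col_select[OF A J(1,2)])
  then have "\<bar>det (col_select A f)\<bar> = \<bar>det (submatrix A UNIV J)\<bar>"
    by (simp add: abs_mult sign_def)
  then show ?thesis using abs_det_submatrix_le_Delta[OF A J(1,2)] by simp
qed

text \<open>A maximal independent set of columns has \<open>m\<close> elements by the rank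
  hypothesis; listing its indices selects a matrix of full rank.\<close>

lemma full_row_rank_nonzero_minor:
  assumes A: "A \<in> carrier_mat m n" and rank: "vec_space.rank m (map_mat real_of_int A) = m"
  obtains f where "\<And>k. k < m \<Longrightarrow> f k < n" "det (col_select A f) \<noteq> 0"
proof -
  interpret vec_space "TYPE(real)" m .
  let ?A = "map_mat real_of_int A"
  have A': "?A \<in> carrier_mat m n" using A by simp
  obtain S where S: "maximal S (\<lambda>T. T \<subseteq> set (cols ?A) \<and> lin_indpt T)" "finite S"
    using maximal_exists_superset[of "set (cols ?A)" "\<lambda>T. T \<subseteq> set (cols ?A) \<and> lin_indpt T" "{}"]
      finite_lin_indpt2[of "{}"] by auto
  have card: "card S = m" using rank_card_indpt[OF A' S(1)] rank by simp
  have SA: "S \<subseteq> set (cols ?A)" "lin_indpt S" using S(1) by (auto simp: maximal_def)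
  obtain h where h: "bij_betw h {..<m} S"
    using ex_bij_betw_nat_finite[OF S(2)] card by (auto simp: atLeast0LessThan)
  have "\<forall>k<m. \<exists>j<n. h k = col ?A j"
  proof (intro allI impI)
    fix k assume "k < m"
    then have "h k \<in> set (cols ?A)" using h SA(1) by (auto simp: bij_betw_def)
    then show "\<exists>j<n. h k = col ?A j" using A by (auto simp: cols_def)
  qed
  then obtain f where f: "\<And>k. k < m \<Longrightarrow> f k < n" "\<And>k. k < m \<Longrightarrow> h k = col ?A (f k)" by metis
  let ?M = "map_mat real_of_int (col_select A f)"
  have M: "?M \<in> carrier_mat m m" using A by simp
  have dm: "dim_row A = m" "dim_col A = n" using A by auto
  have cols: "cols ?M = map h [0..<m]"
    using f A by (intro nth_equalityI) (auto intro!: eq_vecI simp: col_select_def dm)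
  have "distinct (cols ?M)" unfolding cols
    using h by (auto simp: distinct_map bij_betw_def atLeast0LessThan)
  moreover have "set (cols ?M) = S" unfolding cols
    using h by (auto simp: bij_betw_def atLeast0LessThan)
  ultimately have "vec_space.rank m ?M = m" using lin_indpt_full_rank[OF M] SA(2) by simp
  then have "det ?M \<noteq> 0" using det_rank_iff[OF M] by simp
  then show ?thesis using that[OF f(1)] by simp
qed

text \<open>The adjugate applied to column \<open>j\<close> solves the system up to the factor
  \<open>det ?M\<close>, and its coordinates are Cramer's numerators. Keeping that factor on the
  left avoids division, so the identity lives over the integers.\<close>

lemma cramer_columns:
  assumes A: "A \<in> carrier_mat m n" and d: "det (col_select A f) \<noteq> 0" and i: "i < m" and j: "j < n"
  shows "det (col_select A f) * A $$ (i, j)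
      = (\<Sum>k<m. det (col_select A (f(k := j))) * A $$ (i, f k))"
proof -
  let ?M = "col_select A f"
  have M: "?M \<in> carrier_mat m m" using A by simp
  define x where "x = adj_mat ?M *\<^sub>v col A j"
  have ca: "col A j \<in> carrier_vec m" using A by (auto intro: carrier_vecI)
  have x: "x \<in> carrier_vec m" unfolding x_def using adj_mat(1)[OF M] ca by auto
  have Mx: "?M *\<^sub>v x = det ?M \<cdot>\<^sub>v col A j"
  proof -
    have "?M *\<^sub>v x = (?M * adj_mat ?M) *\<^sub>v col A j"
      unfolding x_def using M adj_mat(1)[OF M] ca by (simp add: assoc_mult_mat_vec[of _ m m _ m])
    then show ?thesis unfolding adj_mat(2)[OF M] using ca A by (intro eq_vecI) (auto simp: row_one)
  qed
  have xk: "x $ k = det (col_select A (f(k := j)))" if k: "k < m" for k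
  proof -
    have "x $ k * det ?M = det (replace_col ?M (det ?M \<cdot>\<^sub>v col A j) k)"
      using cramer_lemma_mat[OF M x k] Mx by simp
    \<comment> \<open>The scalar is pulled out of column \<open>k\<close>; transposing twice reduces
      this to the rule for multiplying a row.\<close>
    also have "replace_col ?M (det ?M \<cdot>\<^sub>v col A j) k = (multrow k (det ?M) (col_select A (f(k := j)))\<^sup>T)\<^sup>T"
      using A j k by (intro eq_matI) (auto simp: replace_col_def col_select_def)
    also have "det \<dots> = det ?M * det (col_select A (f(k := j)))"
      using A k det_multrow[of k m "(col_select A (f(k := j)))\<^sup>T" "det ?M"]
      by (simp add: det_transpose[of _ m])
    finally show ?thesis using d by simp
  qed
  have "det ?M * A $$ (i, j) = (?M *\<^sub>v x) $ i"
    unfolding Mx using A i j by auto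
  also have "\<dots> = (\<Sum>k<m. A $$ (i, f k) * x $ k)"
    using A i x by (simp add: col_select_def scalar_prod_def atLeast0LessThan)
  also have "\<dots> = (\<Sum>k<m. det (col_select A (f(k := j))) * A $$ (i, f k))"
    by (intro sum.cong) (auto simp: xk)
  finally show ?thesis .
qed

lemma nonzero_minor_inj_on:
  assumes A: "A \<in> carrier_mat m n" and d: "det (col_select A f) \<noteq> 0"
  shows "inj_on f {..<m}"
proof (rule inj_onI, rule ccontr)
  fix k l assume kl: "k \<in> {..<m}" "l \<in> {..<m}" "f k = f l" "k \<noteq> l"
  have "det (col_select A f) = 0"
    by (rule det_identical_columns[OF col_select_carrier[OF A] kl(4)])
      (use kl A in \<open>auto simp: col_select_def\<close>)
  then show False using d by simp
qed

section \<open>Triangularization by integer row operations\<close>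

text \<open>Euclid's algorithm, one column at a time. Among the unimodular matrices that clear the
  first \<open>c\<close> columns, one that minimizes the absolute column sum \<open>\<mu>\<close> on
  and below the diagonal leaves at most one nonzero entry there; a row swap moves it to the
  diagonal.\<close>

lemma unimodular_triangularization:
  fixes B :: "int mat"
  assumes B: "B \<in> carrier_mat m m"
  obtains U where "U \<in> carrier_mat m m" "\<bar>det U\<bar> = 1" "upper_triangular (U * B)"
proof -
  define P where "P c U \<longleftrightarrow> U \<in> carrier_mat m m \<and> \<bar>det U\<bar> = 1 \<and>
    (\<forall>i<m. \<forall>j<c. j < i \<longrightarrow> (U * B) $$ (i, j) = 0)" for c U
  have "\<exists>U. P c U" if "c \<le> m" for c
    using that
  proof (induction c)
    case 0
    show ?case by (intro exI[of _ "1\<^sub>m m"]) (auto simp: P_def)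
  next
    case (Suc c)
    define \<mu> where "\<mu> U = (\<Sum>i\<in>{c..<m}. nat \<bar>(U * B) $$ (i, c)\<bar>)" for U
    obtain U where U: "P c U" and least: "\<And>V. P c V \<Longrightarrow> \<mu> U \<le> \<mu> V"
      using ex_has_least_nat[of "P c" _ \<mu>] Suc by (metis Suc_leD)
    have Uc: "U \<in> carrier_mat m m" "\<bar>det U\<bar> = 1" using U by (auto simp: P_def)
    let ?H = "U * B"
    have H: "?H \<in> carrier_mat m m" using Uc B by auto
    have dims: "dim_row U = m" "dim_col U = m" "dim_row B = m" "dim_col B = m" using Uc B by auto
    have Hz: "?H $$ (i, j) = 0" if "i < m" "j < c" "j < i" for i j
      using U that by (auto simp: P_def)
    have no_two: "?H $$ (i, c) = 0 \<or> ?H $$ (j, c) = 0"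
      if ij: "c \<le> i" "c \<le> j" "i < m" "j < m" "i \<noteq> j" for i j
    proof (rule ccontr)
      assume "\<not> ?thesis"
      then obtain k l where kl: "c \<le> k" "c \<le> l" "k < m" "l < m" "k \<noteq> l"
        "?H $$ (k, c) \<noteq> 0" "?H $$ (l, c) \<noteq> 0" "\<bar>?H $$ (l, c)\<bar> \<le> \<bar>?H $$ (k, c)\<bar>"
        using ij by (metis linorder_linear)
      \<comment> \<open>The sign is chosen such that adding \<open>a\<close> times row
        \<open>l\<close> to row \<open>k\<close> lowers the absolute value of the entry in column
        \<open>c\<close> by exactly \<open>\<bar>?H $$ (l, c)\<bar>\<close>.\<close>
      define a where "a = - sgn (?H $$ (k, c)) * sgn (?H $$ (l, c))"
      let ?V = "addrow_mat m a k l * U"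
      have VB: "?V * B = addrow a k l ?H"
        using addrow_mat[OF H kl(4)] Uc B by (simp add: assoc_mult_mat[of _ m m _ m _ m])
      have "\<bar>det ?V\<bar> = 1"
        using Uc kl by (simp add: det_mult[of _ m] det_addrow_mat)
      moreover have "(?V * B) $$ (i, j) = 0" if "i < m" "j < c" "j < i" for i j
        unfolding VB using that kl Hz[of i j] Hz[of l j] H Suc.prems by (auto simp: dims)
      ultimately have "P c ?V" using Uc by (auto simp: P_def)
      then have "\<mu> U \<le> \<mu> ?V" by (rule least)
      moreover have "\<mu> ?V < \<mu> U"
        unfolding \<mu>_def
      proof (rule sum_strict_mono_ex1)
        have "\<bar>a * ?H $$ (l, c) + ?H $$ (k, c)\<bar> < \<bar>?H $$ (k, c)\<bar>"
          using kl(6-8) unfolding a_def by (auto simp: sgn_if split: if_splits)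
        then have *: "nat \<bar>(?V * B) $$ (k, c)\<bar> < nat \<bar>?H $$ (k, c)\<bar>"
          unfolding VB using kl Suc.prems by (simp add: dims)
        then show "\<exists>i\<in>{c..<m}. nat \<bar>(?V * B) $$ (i, c)\<bar> < nat \<bar>?H $$ (i, c)\<bar>"
          using kl by auto
        have "nat \<bar>(?V * B) $$ (i, c)\<bar> \<le> nat \<bar>?H $$ (i, c)\<bar>" if "i \<in> {c..<m}" "i \<noteq> k" for i
          unfolding VB using that kl Suc.prems by (simp add: dims)
        then show "\<forall>i\<in>{c..<m}. nat \<bar>(?V * B) $$ (i, c)\<bar> \<le> nat \<bar>?H $$ (i, c)\<bar>"
          using * by (metis less_imp_le)
      qed simp
      ultimately show False by simp
    qed
    show ?case
    proof (cases "\<exists>i. c < i \<and> i < m \<and> ?H $$ (i, c) \<noteq> 0")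
      case False
      then have "P (Suc c) U" using U by (auto simp: P_def less_Suc_eq)
      then show ?thesis ..
    next
      case True
      then obtain i where i: "c < i" "i < m" "?H $$ (i, c) \<noteq> 0" by auto
      let ?V = "swaprows_mat m c i * U"
      have VB: "?V * B = swaprows c i ?H"
        using swaprows_mat[OF H, of c i] Uc B i by (simp add: assoc_mult_mat[of _ m m _ m _ m])
      have "\<bar>det ?V\<bar> = 1"
        using Uc i by (simp add: det_mult[of _ m] det_swaprows_mat)
      moreover have "(?V * B) $$ (k, j) = 0" if "k < m" "j < Suc c" "j < k" for k j
      proof (cases "j = c")
        case True
        then show ?thesis
          unfolding VB using that i no_two[of i k] no_two[of i c] by (auto simp: dims)
      next
        case False
        then show ?thesis
          unfolding VB using that i Hz[of k j] Hz[of i j] Hz[of c j] by (auto simp: dims)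
      qed
      ultimately have "P (Suc c) ?V" using Uc by (auto simp: P_def)
      then show ?thesis ..
    qed
  qed
  then obtain U where "P m U" by blast
  then show ?thesis using that[of U] B by (auto simp: P_def upper_triangular_def)
qed

section \<open>Conformal decomposition into circuits\<close>

text \<open>Kernel vectors are functions that vanish from \<open>dim_col A\<close> on, so that sums,
  multiples and supports need no dimension conditions.\<close>

definition ker :: "int mat \<Rightarrow> (nat \<Rightarrow> real) set" where
  "ker A = {u. (\<forall>j\<ge>dim_col A. u j = 0) \<and>
     (\<forall>i<dim_row A. (\<Sum>j<dim_col A. of_int (A $$ (i, j)) * u j) = 0)}"

abbreviation supp :: "(nat \<Rightarrow> real) \<Rightarrow> nat set" where
  "supp u \<equiv> {j. u j \<noteq> 0}"

text \<open>Linear independence of the columns with index in \<open>S\<close>, read off the kernel.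
  Working with indices makes two equal columns dependent.\<close>

definition indep_cols :: "int mat \<Rightarrow> nat set \<Rightarrow> bool" where
  "indep_cols A S \<longleftrightarrow> (\<forall>u\<in>ker A. supp u \<subseteq> S \<longrightarrow> u = (\<lambda>_. 0))"

definition conformal :: "(nat \<Rightarrow> real) \<Rightarrow> (nat \<Rightarrow> real) \<Rightarrow> bool" where
  "conformal u v \<longleftrightarrow> (\<forall>j. (u j > 0 \<longrightarrow> v j > 0) \<and> (u j < 0 \<longrightarrow> v j < 0))"

lemma conformal_trans: "conformal u v \<Longrightarrow> conformal v w \<Longrightarrow> conformal u w"
  by (auto simp: conformal_def)

lemma conformal_supp: "conformal u v \<Longrightarrow> supp u \<subseteq> supp v"
  by (force simp: conformal_def neq_iff)

lemma ker_supp: "A \<in> carrier_mat m n \<Longrightarrow> u \<in> ker A \<Longrightarrow> supp u \<subseteq> {..<n}"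
  unfolding ker_def by (auto simp: not_less[symmetric])

lemma ker_finite_supp: "A \<in> carrier_mat m n \<Longrightarrow> u \<in> ker A \<Longrightarrow> finite (supp u)"
  using ker_supp finite_subset by (metis finite_lessThan)

lemma ker_zero: "(\<lambda>_. 0) \<in> ker A"
  by (simp add: ker_def)

lemma ker_add: "u \<in> ker A \<Longrightarrow> w \<in> ker A \<Longrightarrow> (\<lambda>j. u j + w j) \<in> ker A"
  by (auto simp: ker_def sum.distrib distrib_left)

lemma ker_scale: "u \<in> ker A \<Longrightarrow> (\<lambda>j. c * u j) \<in> ker A"
  by (auto simp: ker_def mult.left_commute[of _ c] simp flip: sum_distrib_left)

lemma ker_diff_scale: "u \<in> ker A \<Longrightarrow> w \<in> ker A \<Longrightarrow> (\<lambda>j. u j - c * w j) \<in> ker A"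
  using ker_add[OF _ ker_scale[of w A "- c"], of u] by simp

lemma ker_sum: "finite K \<Longrightarrow> (\<And>k. k \<in> K \<Longrightarrow> u k \<in> ker A) \<Longrightarrow> (\<lambda>j. \<Sum>k\<in>K. u k j) \<in> ker A"
  by (induction K rule: finite_induct) (auto intro!: ker_add ker_zero)

lemma indep_colsD: "indep_cols A S \<Longrightarrow> u \<in> ker A \<Longrightarrow> supp u \<subseteq> S \<Longrightarrow> u j = 0"
  by (auto simp: indep_cols_def)

text \<open>Read along \<open>f\<close>, a kernel vector supported on the selected columns solves
  the homogeneous system of a nonsingular matrix.\<close>

lemma indep_cols_nonzero_minor:
  assumes A: "A \<in> carrier_mat m n" and f: "\<And>k. k < m \<Longrightarrow> f k < n"
    and d: "det (col_select A f) \<noteq> 0"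
  shows "indep_cols A (f ` {..<m})"
  unfolding indep_cols_def
proof (intro ballI impI)
  fix u assume u: "u \<in> ker A" "supp u \<subseteq> f ` {..<m}"
  note inj = nonzero_minor_inj_on[OF A d]
  let ?M = "map_mat real_of_int (col_select A f)"
  have M: "?M \<in> carrier_mat m m" using A by simp
  define x where "x = vec m (\<lambda>k. u (f k))"
  have "(?M *\<^sub>v x) $ i = 0" if i: "i < m" for i
  proof -
    have "(?M *\<^sub>v x) $ i = (\<Sum>k<m. of_int (A $$ (i, f k)) * u (f k))"
      using A i by (simp add: x_def col_select_def scalar_prod_def atLeast0LessThan)
    also have "\<dots> = (\<Sum>j\<in>f ` {..<m}. of_int (A $$ (i, j)) * u j)"
      using inj by (simp add: sum.reindex)
    also have "\<dots> = (\<Sum>j<n. of_int (A $$ (i, j)) * u j)"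
      using u f by (intro sum.mono_neutral_left) auto
    also have "\<dots> = 0" using u(1) A i by (auto simp: ker_def)
    finally show ?thesis .
  qed
  then have "?M *\<^sub>v x = 0\<^sub>v m" using M by (intro eq_vecI) auto
  moreover have "det ?M \<noteq> 0" using d by simp
  ultimately have "x = 0\<^sub>v m"
    using det_0_iff_vec_prod_zero_field[OF M] vec_carrier[of m "\<lambda>k. u (f k)"]
    unfolding x_def by blast
  then have "u (f k) = 0" if "k < m" for k
    using that by (metis index_vec index_zero_vec(1) x_def)
  then show "u = (\<lambda>_. 0)" using u(2) by force
qed

text \<open>Cramer's rule, cleared of denominators: the dependence of column \<open>p\<close> on the basis \<open>f\<close>.\<close>

definition circuit_vec :: "int mat \<Rightarrow> (nat \<Rightarrow> nat) \<Rightarrow> nat \<Rightarrow> nat \<Rightarrow> int" where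
  "circuit_vec A f p j = (if j = p then - det (col_select A f) else 0)
     + (\<Sum>k<dim_row A. if f k = j then det (col_select A (f(k := p))) else 0)"

lemma circuit_vec_ker:
  assumes A: "A \<in> carrier_mat m n" and f: "\<And>k. k < m \<Longrightarrow> f k < n" and p: "p < n"
    and d: "det (col_select A f) \<noteq> 0"
  shows "(\<lambda>j. of_int (circuit_vec A f p j)) \<in> ker A"
proof -
  have dims: "dim_row A = m" "dim_col A = n" using A by auto
  have "(\<Sum>j<n. A $$ (i, j) * circuit_vec A f p j) = 0" if i: "i < m" for i
  proof -
    let ?D = "\<lambda>k. det (col_select A (f(k := p)))"
    have "(\<Sum>j<n. A $$ (i, j) * circuit_vec A f p j)
       = (\<Sum>j<n. A $$ (i, j) * (if j = p then - det (col_select A f) else 0))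
         + (\<Sum>j<n. \<Sum>k<m. A $$ (i, j) * (if f k = j then ?D k else 0))"
      by (simp add: circuit_vec_def dims distrib_left sum.distrib sum_distrib_left)
    also have "(\<Sum>j<n. A $$ (i, j) * (if j = p then - det (col_select A f) else 0))
       = (\<Sum>j<n. if j = p then A $$ (i, j) * - det (col_select A f) else 0)"
      by (intro sum.cong) auto
    also have "\<dots> = - (det (col_select A f) * A $$ (i, p))"
      using p by (simp add: sum.delta)
    also have "(\<Sum>j<n. \<Sum>k<m. A $$ (i, j) * (if f k = j then ?D k else 0))
        = (\<Sum>k<m. \<Sum>j<n. A $$ (i, j) * (if f k = j then ?D k else 0))"
      by (rule sum.swap)
    also have "\<dots> = (\<Sum>k<m. ?D k * A $$ (i, f k))"
    proof (intro sum.cong refl)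
      fix k assume "k \<in> {..<m}"
      then have fk: "f k < n" using f by simp
      have "(\<Sum>j<n. A $$ (i, j) * (if f k = j then ?D k else 0))
          = (\<Sum>j<n. if f k = j then A $$ (i, j) * ?D k else 0)"
        by (intro sum.cong) auto
      then show "(\<Sum>j<n. A $$ (i, j) * (if f k = j then ?D k else 0)) = ?D k * A $$ (i, f k)"
        using fk by (simp add: sum.delta')
    qed
    finally show ?thesis using cramer_columns[OF A d i p] by simp
  qed
  then have "(\<Sum>j<n. real_of_int (A $$ (i, j)) * real_of_int (circuit_vec A f p j)) = 0" if "i < m" for i
    using that by (metis (mono_tags, lifting) of_int_0 of_int_mult of_int_sum sum.cong)
  moreover have "circuit_vec A f p j = 0" if "j \<ge> n" for j
    using that f p by (force simp: circuit_vec_def dims intro!: sum.neutral)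
  ultimately show ?thesis by (simp add: ker_def dims)
qed

lemma circuit_vec_values:
  assumes A: "A \<in> carrier_mat m n" and d: "det (col_select A f) \<noteq> 0" and p: "p \<notin> f ` {..<m}"
  shows "circuit_vec A f p p = - det (col_select A f)"
    and "k < m \<Longrightarrow> circuit_vec A f p (f k) = det (col_select A (f(k := p)))"
    and "j \<notin> insert p (f ` {..<m}) \<Longrightarrow> circuit_vec A f p j = 0"
proof -
  have dims: "dim_row A = m" "dim_col A = n" using A by auto
  show "circuit_vec A f p p = - det (col_select A f)"
    using p by (auto simp: circuit_vec_def dims intro!: sum.neutral)
  show "j \<notin> insert p (f ` {..<m}) \<Longrightarrow> circuit_vec A f p j = 0"
    by (auto simp: circuit_vec_def dims intro!: sum.neutral)
  assume k: "k < m"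
  have "(\<Sum>l<m. if f l = f k then det (col_select A (f(l := p))) else 0)
     = (\<Sum>l<m. if l = k then det (col_select A (f(l := p))) else 0)"
    using nonzero_minor_inj_on[OF A d] k by (intro sum.cong) (auto simp: inj_on_def)
  then show "circuit_vec A f p (f k) = det (col_select A (f(k := p)))"
    using k p by (auto simp: circuit_vec_def dims sum.delta)
qed

text \<open>Steinitz exchange: among the nonsingular selections, take one that covers as much of
  \<open>C\<close> as possible. If it missed \<open>p\<close> in \<open>C\<close>, the circuit of
  \<open>p\<close> would have a nonzero entry at some \<open>f k\<close> outside \<open>C\<close>;
  that entry is the determinant after putting \<open>p\<close> in place of \<open>f k\<close>, so a
  better selection would exist.\<close>

lemma indep_cols_extend:
  assumes A: "A \<in> carrier_mat m n"
    and ex: "\<exists>f. (\<forall>k<m. f k < n) \<and> det (col_select A f) \<noteq> 0"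
    and C: "C \<subseteq> {..<n}" "indep_cols A C"
  obtains f where "\<And>k. k < m \<Longrightarrow> f k < n" "det (col_select A f) \<noteq> 0" "C \<subseteq> f ` {..<m}"
proof -
  let ?P = "\<lambda>f. (\<forall>k<m. f k < n) \<and> det (col_select A f) \<noteq> 0"
  let ?\<mu> = "\<lambda>f. card (C \<inter> f ` {..<m})"
  have fin: "finite (C \<inter> X)" for X using C(1) finite_subset by blast
  obtain f0 where f0: "?P f0" using ex by blast
  have "?\<mu> f < Suc m" for f
    using card_image_le[of "{..<m}" f] card_mono[of "f ` {..<m}" "C \<inter> f ` {..<m}"] by simp
  then have "\<exists>f. ?P f \<and> (\<forall>h. ?P h \<longrightarrow> ?\<mu> h \<le> ?\<mu> f)"
    by (intro ex_has_greatest_nat[of ?P f0 ?\<mu> "Suc m", OF f0]) blast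
  then obtain f where f: "?P f" and greatest: "\<And>h. ?P h \<Longrightarrow> ?\<mu> h \<le> ?\<mu> f" by blast
  have fn: "\<And>k. k < m \<Longrightarrow> f k < n" and d: "det (col_select A f) \<noteq> 0" using f by auto
  have "C \<subseteq> f ` {..<m}"
  proof (rule ccontr)
    assume "\<not> ?thesis"
    then obtain p where p: "p \<in> C" "p \<notin> f ` {..<m}" by auto
    have pn: "p < n" using p C by auto
    note vals = circuit_vec_values[OF A d p(2)]
    let ?w = "\<lambda>j. real_of_int (circuit_vec A f p j)"
    \<comment> \<open>The circuit is nonzero at \<open>p\<close>, so the independence of
      \<open>C\<close> forbids that its support lies in \<open>C\<close>.\<close>
    have "\<not> supp ?w \<subseteq> C"
      using indep_colsD[OF C(2) circuit_vec_ker[OF A fn pn d], of p] vals(1) d by auto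
    then obtain j where j: "circuit_vec A f p j \<noteq> 0" "j \<notin> C" by auto
    then obtain k where k: "k < m" "j = f k" using vals(3)[of j] p by auto
    have "?P (f(k := p))" using j k fn pn vals(2)[OF k(1)] by auto
    then have "?\<mu> (f(k := p)) \<le> ?\<mu> f" by (rule greatest)
    moreover have "insert p (C \<inter> f ` {..<m}) \<subseteq> C \<inter> (f(k := p)) ` {..<m}"
      using p k j by (auto simp: image_iff)
    then have "card (insert p (C \<inter> f ` {..<m})) \<le> ?\<mu> (f(k := p))"
      using fin by (intro card_mono) auto
    ultimately show False using p fin by simp
  qed
  then show ?thesis using that fn d by blast
qed

text \<open>Ratio test: \<open>\<nu>\<close> is the largest multiple of \<open>w\<close> that can be
  subtracted from \<open>v\<close> without changing a sign. Only coordinates where both have the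
  same sign limit it, since all others stay put or move away from zero; the minimizing coordinate
  \<open>j\<close> becomes zero.\<close>

lemma conformal_reduce:
  assumes fin: "finite (supp w)" and sub: "supp w \<subseteq> supp v" and pos: "w j0 * v j0 > 0"
  obtains \<nu> j where "\<nu> > 0" "w j \<noteq> 0" "v j = \<nu> * w j" "conformal (\<lambda>i. v i - \<nu> * w i) v"
proof -
  define T where "T = {j. w j * v j > 0}"
  have T: "finite T" "T \<noteq> {}" using fin pos by (auto simp: T_def intro: finite_subset[OF _ fin])
  define \<nu> where "\<nu> = Min ((\<lambda>j. v j / w j) ` T)"
  have "\<nu> \<in> (\<lambda>j. v j / w j) ` T" unfolding \<nu>_def using T by (intro Min_in) auto
  then obtain j where j: "j \<in> T" "\<nu> = v j / w j" by auto
  have le: "\<nu> \<le> v i / w i" if "i \<in> T" for i unfolding \<nu>_def using T that by auto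
  have l0: "\<nu> > 0" using j by (auto simp: T_def zero_less_divide_iff zero_less_mult_iff)
  have "conformal (\<lambda>i. v i - \<nu> * w i) v"
    unfolding conformal_def
  proof (intro allI)
    fix i
    consider "v i = 0" | "i \<in> T" "w i > 0" "v i > 0" | "i \<in> T" "w i < 0" "v i < 0"
      | "v i > 0" "w i \<le> 0" | "v i < 0" "w i \<ge> 0"
      unfolding T_def by (force simp: zero_less_mult_iff)
    then show "(v i - \<nu> * w i > 0 \<longrightarrow> v i > 0) \<and> (v i - \<nu> * w i < 0 \<longrightarrow> v i < 0)"
    proof cases
      case 1
      then have "w i = 0" using sub by auto
      then show ?thesis using 1 by simp
    next
      case 2
      then have "\<nu> * w i \<le> v i" using le[of i] by (simp add: field_simps)
      then show ?thesis using 2 by simp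
    next
      case 3
      then have "\<nu> * w i \<ge> v i" using le[of i] by (simp add: field_simps)
      then show ?thesis using 3 by simp
    next
      case 4
      then have "\<nu> * w i \<le> 0" using l0 by (simp add: mult_nonneg_nonpos)
      then show ?thesis using 4 by simp
    next
      case 5
      then have "\<nu> * w i \<ge> 0" using l0 by simp
      then show ?thesis using 5 by simp
    qed
  qed
  moreover have "w j \<noteq> 0" using j(1) by (auto simp: T_def)
  moreover from this have "v j = \<nu> * w j" by (simp add: j(2))
  ultimately show ?thesis using that l0 by blast
qed

text \<open>Take a nonzero kernel vector \<open>u\<close> conformal to \<open>v\<close> of minimal
  support. By the ratio test every kernel vector supported inside \<open>supp u\<close> is a
  multiple of \<open>u\<close>, so removing one index \<open>p\<close> leaves independent columns.
  These extend to a basis, and \<open>u\<close> is a multiple of the circuit of \<open>p\<close>,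
  whose entries are minors.\<close>

lemma conformal_circuit:
  assumes A: "A \<in> carrier_mat m n" and mn: "m \<le> n"
    and ex: "\<exists>f. (\<forall>k<m. f k < n) \<and> det (col_select A f) \<noteq> 0"
    and v: "v \<in> ker A" "v \<noteq> (\<lambda>_. 0)"
  obtains g :: "nat \<Rightarrow> int" where "(\<lambda>j. of_int (g j)) \<in> ker A" "conformal (\<lambda>j. of_int (g j)) v"
    "\<exists>j. g j \<noteq> 0" "\<And>j. \<bar>g j\<bar> \<le> Delta A" "card {j. g j \<noteq> 0} \<le> m + 1"
proof -
  let ?P = "\<lambda>u. u \<in> ker A \<and> u \<noteq> (\<lambda>_. 0) \<and> conformal u v"
  obtain u where u: "?P u" and least: "\<And>w. ?P w \<Longrightarrow> card (supp u) \<le> card (supp w)"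
    using ex_has_least_nat[of ?P v "\<lambda>w. card (supp w)"] v by (auto simp: conformal_def)
  have uk: "u \<in> ker A" using u by simp
  note finu = ker_finite_supp[OF A uk]
  have multiple: "\<exists>c. \<forall>j. w j = c * u j" if w: "w \<in> ker A" "supp w \<subseteq> supp u" for w
  proof (cases "w = (\<lambda>_. 0)")
    case True
    then show ?thesis by (intro exI[of _ 0]) auto
  next
    case False
    then obtain j0 where j0: "w j0 \<noteq> 0" by auto
    then have uj0: "u j0 \<noteq> 0" using w by auto
    \<comment> \<open>The sign makes \<open>s * w\<close> agree with \<open>u\<close> at
      \<open>j0\<close>, which the ratio test requires.\<close>
    define s where "s = sgn (w j0 * u j0)"
    have s: "s \<noteq> 0" using j0 uj0 by (simp add: s_def sgn_0_0)
    let ?w = "\<lambda>j. s * w j"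
    have wk: "?w \<in> ker A" using w by (intro ker_scale)
    have "?w j0 * u j0 = \<bar>w j0 * u j0\<bar>" by (simp add: s_def mult.assoc abs_sgn mult.commute)
    then have pos: "?w j0 * u j0 > 0" using j0 uj0 by simp
    have sub: "supp ?w \<subseteq> supp u" using w by auto
    obtain \<nu> j where \<nu>: "\<nu> > 0" "?w j \<noteq> 0" "u j = \<nu> * ?w j" "conformal (\<lambda>i. u i - \<nu> * ?w i) u"
      using conformal_reduce[OF ker_finite_supp[OF A wk] sub pos] by metis
    let ?u = "\<lambda>i. u i - \<nu> * ?w i"
    have "?u \<in> ker A" using uk wk by (rule ker_diff_scale)
    moreover have "conformal ?u v" using \<nu>(4) u conformal_trans by blast
    moreover have "card (supp ?u) < card (supp u)"
    proof (rule psubset_card_mono[OF finu])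
      have "j \<in> supp u" "j \<notin> supp ?u" using \<nu> by auto
      then show "supp ?u \<subset> supp u" using conformal_supp[OF \<nu>(4)] by blast
    qed
    ultimately have "?u = (\<lambda>_. 0)" using least[of ?u] by linarith
    then have "u j = \<nu> * (s * w j)" for j by (simp add: fun_eq_iff)
    then have "w j = 1 / (\<nu> * s) * u j" for j using \<nu>(1) s by simp
    then show ?thesis by blast
  qed
  obtain p where p: "u p \<noteq> 0" using u by auto
  define C where "C = supp u - {p}"
  have Cn: "C \<subseteq> {..<n}" using ker_supp[OF A uk] by (auto simp: C_def)
  have "indep_cols A C"
    unfolding indep_cols_def
  proof (intro ballI impI)
    fix x assume x: "x \<in> ker A" "supp x \<subseteq> C"
    then obtain c where c: "\<And>j. x j = c * u j" using multiple[of x] by (auto simp: C_def)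
    have "x p = 0" using x by (auto simp: C_def)
    then have "c = 0" using c p by simp
    then show "x = (\<lambda>_. 0)" using c by auto
  qed
  then obtain f where f: "\<And>k. k < m \<Longrightarrow> f k < n" "det (col_select A f) \<noteq> 0" "C \<subseteq> f ` {..<m}"
    using indep_cols_extend[OF A ex Cn] by metis
  note ind = indep_cols_nonzero_minor[OF A f(1,2)]
  have pn: "p < n" using ker_supp[OF A uk] p by auto
  have pf: "p \<notin> f ` {..<m}"
  proof
    assume "p \<in> f ` {..<m}"
    then have "supp u \<subseteq> f ` {..<m}" using f(3) by (auto simp: C_def)
    then show False using indep_colsD[OF ind uk, of p] p by simp
  qed
  note vals = circuit_vec_values[OF A f(2) pf]
  let ?d = "real_of_int (det (col_select A f))"
  let ?h = "\<lambda>j. real_of_int (circuit_vec A f p j)"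
  have hk: "?h \<in> ker A" using circuit_vec_ker[OF A f(1) pn f(2)] by simp
  \<comment> \<open>The multiple of \<open>?h\<close> is chosen to cancel \<open>u\<close> at
    \<open>p\<close>, where \<open>?h\<close> equals \<open>- ?d\<close>. The difference is a kernel
    vector supported on independent columns, hence zero.\<close>
  have y0: "u j - - (u p / ?d) * ?h j = 0" for j
  proof (rule indep_colsD[OF ind ker_diff_scale[OF uk hk]])
    show "supp (\<lambda>j. u j - - (u p / ?d) * ?h j) \<subseteq> f ` {..<m}"
    proof (rule subsetI, rule ccontr)
      fix j assume j: "j \<in> supp (\<lambda>j. u j - - (u p / ?d) * ?h j)" "j \<notin> f ` {..<m}"
      show False
      proof (cases "j = p")
        case True
        then show ?thesis using j vals(1) f(2) by simp
      next
        case False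
        then have "u j = 0" using j(2) f(3) by (auto simp: C_def)
        moreover have "?h j = 0" using vals(3)[of j] j(2) False by simp
        ultimately show ?thesis using j(1) by simp
      qed
    qed
  qed
  define \<kappa> where "\<kappa> = - (?d / u p)"
  have \<kappa>: "\<kappa> \<noteq> 0" using f(2) p by (simp add: \<kappa>_def)
  have h: "?h j = \<kappa> * u j" for j
    using y0[of j] f(2) p by (simp add: \<kappa>_def field_simps)
  \<comment> \<open>The sign turns the circuit vector into a positive multiple of \<open>u\<close>,
    which makes it conformal.\<close>
  define e :: int where "e = (if \<kappa> > 0 then 1 else - 1)"
  define g where "g j = e * circuit_vec A f p j" for j
  have e: "e \<noteq> 0" "\<bar>e\<bar> = 1" by (auto simp: e_def)
  have g: "real_of_int (g j) = \<bar>\<kappa>\<bar> * u j" for j using h[of j] by (auto simp: g_def e_def)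
  show ?thesis
  proof
    show "(\<lambda>j. of_int (g j)) \<in> ker A" unfolding g using uk by (rule ker_scale)
    have "conformal (\<lambda>j. of_int (g j)) u" unfolding g conformal_def
      using \<kappa> by (auto simp: zero_less_mult_iff mult_less_0_iff)
    then show "conformal (\<lambda>j. of_int (g j)) v" using u conformal_trans by blast
    show "\<exists>j. g j \<noteq> 0" using vals(1) f(2) e by (auto simp: g_def intro!: exI[of _ p])
    fix j
    have D: "\<bar>det (col_select A f')\<bar> \<le> Delta A" if "\<And>k. k < m \<Longrightarrow> f' k < n" for f'
      using abs_det_col_select_le_Delta[OF A mn] that by blast
    consider "j = p" | k where "k < m" "j = f k" | "j \<notin> insert p (f ` {..<m})" by auto
    then have "\<bar>circuit_vec A f p j\<bar> \<le> Delta A"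
    proof cases
      case 1
      then show ?thesis using vals(1) D[of f] f(1) by simp
    next
      case (2 k)
      then show ?thesis using vals(2) D[of "f(k := p)"] f(1) pn by simp
    next
      case 3
      then show ?thesis using vals(3) D[of f] f(1) by simp
    qed
    then show "\<bar>g j\<bar> \<le> Delta A" using e by (simp add: g_def abs_mult)
  next
    have "{j. g j \<noteq> 0} \<subseteq> insert p (f ` {..<m})" using vals(3) by (auto simp: g_def)
    then have "card {j. g j \<noteq> 0} \<le> card (insert p (f ` {..<m}))" by (intro card_mono) auto
    also have "\<dots> \<le> m + 1"
      using card_image_le[of "{..<m}" f] card_insert_le_m1[of "m + 1" "f ` {..<m}" p] by simp
    finally show "card {j. g j \<noteq> 0} \<le> m + 1" .
  qed
qed

text \<open>If no replacement for \<open>j\<close> worked, every column of \<open>supp g\<close>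
  outside \<open>S\<close> would depend on \<open>S - {j}\<close>. Substituting these dependences
  into \<open>g\<close> would give a kernel vector supported on \<open>S\<close> that is still
  nonzero at \<open>j\<close>.\<close>

lemma indep_cols_exchange:
  assumes A: "A \<in> carrier_mat m n" and S: "indep_cols A S" "j \<in> S" and g: "g \<in> ker A" "g j \<noteq> 0"
  shows "\<exists>k. g k \<noteq> 0 \<and> k \<notin> S \<and> indep_cols A (insert k (S - {j}))"
proof (rule ccontr)
  assume contra: "\<not> ?thesis"
  define K where "K = supp g - S"
  have finK: "finite K" using ker_finite_supp[OF A g(1)] by (simp add: K_def)
  have "\<forall>k\<in>K. \<exists>u\<in>ker A. supp u \<subseteq> insert k (S - {j}) \<and> u \<noteq> (\<lambda>_. 0)"
  proof
    fix k assume "k \<in> K"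
    then have "\<not> indep_cols A (insert k (S - {j}))" using contra by (auto simp: K_def)
    then show "\<exists>u\<in>ker A. supp u \<subseteq> insert k (S - {j}) \<and> u \<noteq> (\<lambda>_. 0)"
      unfolding indep_cols_def by blast
  qed
  then obtain u where u: "\<And>k. k \<in> K \<Longrightarrow> u k \<in> ker A"
    "\<And>k. k \<in> K \<Longrightarrow> supp (u k) \<subseteq> insert k (S - {j})" "\<And>k. k \<in> K \<Longrightarrow> u k \<noteq> (\<lambda>_. 0)"
    by metis
  have ukk: "u k k \<noteq> 0" if k: "k \<in> K" for k
  proof
    assume "u k k = 0"
    then have "supp (u k) \<subseteq> S" using u(2)[OF k] by auto
    then show False using S(1) u(1,3)[OF k] by (auto simp: indep_cols_def)
  qed
  have zero: "u k l = 0" if "k \<in> K" "l \<notin> S - {j}" "l \<noteq> k" for k l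
    using u(2)[OF that(1)] that by auto
  \<comment> \<open>Each \<open>u k\<close> is scaled to cancel the coordinate \<open>k\<close> of
    \<open>g\<close>. All of them vanish at \<open>j\<close>, so \<open>g j\<close> is
    unaffected.\<close>
  let ?t = "\<lambda>l. \<Sum>k\<in>K. (g k / u k k) * u k l"
  have "?t \<in> ker A" by (intro ker_sum[OF finK] ker_scale u(1))
  then have "(\<lambda>l. g l - 1 * ?t l) \<in> ker A" using ker_diff_scale[OF g(1)] by blast
  moreover have "supp (\<lambda>l. g l - 1 * ?t l) \<subseteq> S"
  proof (rule subsetI, rule ccontr)
    fix l assume l: "l \<in> supp (\<lambda>l. g l - 1 * ?t l)" "l \<notin> S"
    have "?t l = (\<Sum>k\<in>K. if k = l then g l else 0)"
      using l(2) ukk by (intro sum.cong) (auto simp: zero)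
    also have "\<dots> = g l" using finK l(2) by (auto simp: K_def)
    finally show False using l(1) by simp
  qed
  ultimately have "g j - 1 * ?t j = 0" using indep_colsD[OF S(1)] by blast
  moreover have "u k j = 0" if "k \<in> K" for k
    using zero[OF that, of j] S(2) that by (auto simp: K_def)
  then have "?t j = 0" by simp
  ultimately show False using g(2) by simp
qed

text \<open>Each round subtracts a multiple of a circuit that makes one more coordinate
  \<open>j\<close> vanish and deletes \<open>j\<close> from \<open>W\<close>. The set
  \<open>S\<close> is kept, or changed by an exchange if it contains \<open>j\<close>, so that
  \<open>W - S\<close> loses exactly one element. The independent set \<open>S\<close> thus lowers
  the number of circuits from \<open>card W\<close> to \<open>card (W - S)\<close>.\<close>

lemma conformal_decomposition:
  assumes A: "A \<in> carrier_mat m n" and mn: "m \<le> n"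
    and ex: "\<exists>f. (\<forall>k<m. f k < n) \<and> det (col_select A f) \<noteq> 0"
    and "v \<in> ker A" "supp v \<subseteq> W" "finite W" "S \<subseteq> W" "indep_cols A S" "card (W - S) = N"
  shows "\<exists>\<nu> (g :: nat \<Rightarrow> nat \<Rightarrow> int). (\<forall>i<N. \<nu> i \<ge> 0 \<and> (\<lambda>j. of_int (g i j)) \<in> ker A
      \<and> conformal (\<lambda>j. of_int (g i j)) v \<and> (\<forall>j. \<bar>g i j\<bar> \<le> Delta A) \<and> card {j. g i j \<noteq> 0} \<le> m + 1)
      \<and> (\<forall>j. v j = (\<Sum>i<N. \<nu> i * of_int (g i j)))"
  using assms(4-)
proof (induction N arbitrary: v W S)
  case 0
  have "W - S = {}" using 0(3,6) by simp
  then have "supp v \<subseteq> S" using 0(2) by blast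
  then have "v = (\<lambda>_. 0)" using 0(1,5) unfolding indep_cols_def by blast
  then show ?case by simp
next
  case (Suc N)
  show ?case
  proof (cases "v = (\<lambda>_. 0)")
    case True
    \<comment> \<open>Nothing is left to decompose, so zero vectors fill the list; they satisfy the
      entry bound because \<open>Delta A\<close> is nonnegative.\<close>
    have "Delta A \<ge> 0" using ex abs_det_col_select_le_Delta[OF A mn] by (metis abs_ge_zero order_trans)
    then show ?thesis
      using True by (intro exI[of _ "\<lambda>_. 0"] exI[of _ "\<lambda>_ _. 0"]) (auto simp: ker_zero conformal_def)
  next
    case False
    obtain h :: "nat \<Rightarrow> int" where h: "(\<lambda>j. of_int (h j)) \<in> ker A" "conformal (\<lambda>j. of_int (h j)) v"
      "\<exists>j. h j \<noteq> 0" "\<And>j. \<bar>h j\<bar> \<le> Delta A" "card {j. h j \<noteq> 0} \<le> m + 1"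
      using conformal_circuit[OF A mn ex Suc.prems(1) False] by blast
    let ?h = "\<lambda>j. real_of_int (h j)"
    obtain j0 where j0: "h j0 \<noteq> 0" using h(3) by auto
    then have "?h j0 * v j0 > 0" using h(2) by (auto simp: conformal_def zero_less_mult_iff neq_iff)
    then obtain \<mu> j where \<mu>: "\<mu> > 0" "?h j \<noteq> 0" "v j = \<mu> * ?h j" "conformal (\<lambda>i. v i - \<mu> * ?h i) v"
      using conformal_reduce[OF ker_finite_supp[OF A h(1)] conformal_supp[OF h(2)]] by metis
    let ?v = "\<lambda>i. v i - \<mu> * ?h i"
    have vk: "?v \<in> ker A" by (rule ker_diff_scale[OF Suc.prems(1) h(1)])
    have hW: "supp ?h \<subseteq> W" using conformal_supp[OF h(2)] Suc.prems(2) by blast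
    have vs: "supp ?v \<subseteq> W - {j}" using conformal_supp[OF \<mu>(4)] Suc.prems(2) \<mu>(3) by auto
    have finWS: "finite (W - S)" using Suc.prems(3) by simp
    obtain S' where S': "S' \<subseteq> W - {j}" "indep_cols A S'" "card (W - {j} - S') = N"
    proof (cases "j \<in> S")
      case False
      have "W - {j} - S = (W - S) - {j}" by auto
      moreover have "j \<in> W - S" using False \<mu>(2) hW by auto
      ultimately have "card (W - {j} - S) = N" using Suc.prems(6) finWS by simp
      then show ?thesis using that[of S] False Suc.prems by auto
    next
      case True
      obtain k where k: "?h k \<noteq> 0" "k \<notin> S" "indep_cols A (insert k (S - {j}))"
        using indep_cols_exchange[OF A Suc.prems(5) True h(1) \<mu>(2)] by blast
      have "W - {j} - insert k (S - {j}) = (W - S) - {k}" using True by auto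
      moreover have "k \<in> W - S" using k hW by auto
      ultimately have "card (W - {j} - insert k (S - {j})) = N" using Suc.prems(6) finWS by simp
      moreover have "insert k (S - {j}) \<subseteq> W - {j}" using k hW True Suc.prems(4) by auto
      ultimately show ?thesis using that k(3) by blast
    qed
    obtain \<nu> and g :: "nat \<Rightarrow> nat \<Rightarrow> int" where IH: "\<And>i. i < N \<Longrightarrow> \<nu> i \<ge> 0 \<and> (\<lambda>j. of_int (g i j)) \<in> ker A
      \<and> conformal (\<lambda>j. of_int (g i j)) ?v \<and> (\<forall>j. \<bar>g i j\<bar> \<le> Delta A) \<and> card {j. g i j \<noteq> 0} \<le> m + 1"
      "\<And>j. ?v j = (\<Sum>i<N. \<nu> i * of_int (g i j))"
      using Suc.IH[OF vk vs finite_Diff[OF Suc.prems(3)] S'] by blast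
    show ?thesis
    proof (intro exI[of _ "\<nu>(N := \<mu>)"] exI[of _ "g(N := h)"] conjI allI impI)
      fix i assume i: "i < Suc N"
      show "0 \<le> (\<nu>(N := \<mu>)) i" "(\<lambda>j. of_int ((g(N := h)) i j)) \<in> ker A"
        "card {j. (g(N := h)) i j \<noteq> 0} \<le> m + 1"
        using i IH(1)[of i] \<mu>(1) h by (auto simp: less_Suc_eq)
      show "\<bar>(g(N := h)) i j\<bar> \<le> Delta A" for j
        using i IH(1)[of i] h(4)[of j] by (auto simp: less_Suc_eq)
      show "conformal (\<lambda>j. of_int ((g(N := h)) i j)) v"
        using i IH(1)[of i] h(2) \<mu>(4) conformal_trans by (auto simp: less_Suc_eq)
    next
      fix l
      show "v l = (\<Sum>i<Suc N. (\<nu>(N := \<mu>)) i * of_int ((g(N := h)) i l))"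
        using IH(2)[of l] by (simp add: algebra_simps)
    qed
  qed
qed

section \<open>Distinct subset sums in a lattice\<close>

text \<open>The difference of both sides vanishes at zero and has derivative
  \<open>exp x + exp (- x) - 2\<close>, which is nonnegative; this is the bound of sinh from below
  by the identity.\<close>

lemma two_mult_le_exp_diff:
  fixes h :: real
  assumes "h \<ge> 0"
  shows "2 * h \<le> exp h - exp (- h)"
proof -
  have "exp 0 - exp (- 0) - 2 * 0 \<le> exp h - exp (- h) - 2 * h"
  proof (rule DERIV_nonneg_imp_nondecreasing[OF assms])
    fix x :: real
    have "((\<lambda>h. exp h - exp (- h) - 2 * h) has_real_derivative exp x + exp (- x) - 2) (at x)"
      by (auto intro!: derivative_eq_intros)
    moreover have "exp x + exp (- x) - 2 \<ge> 0"
      using exp_ge_add_one_self[of x] exp_ge_add_one_self[of "- x"] by linarith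
    ultimately show "\<exists>y. ((\<lambda>h. exp h - exp (- h) - 2 * h) has_real_derivative y) (at x) \<and> 0 \<le> y"
      by blast
  qed
  then show ?thesis by simp
qed

text \<open>The left side is coth of \<beta>/2. Its square is 1 plus the inverse square of sinh of
  \<beta>/2, and that sinh is at least \<beta>/2.\<close>

lemma coth_le_sqrt:
  fixes \<beta> :: real
  assumes \<beta>: "\<beta> > 0"
  shows "(1 + exp (- \<beta>)) / (1 - exp (- \<beta>)) \<le> sqrt (1 + 4 / \<beta>\<^sup>2)"
proof (rule real_le_rsqrt)
  define r where "r = exp (- (\<beta> / 2))"
  have r: "exp (- \<beta>) = r\<^sup>2" "r > 0"
    by (auto simp: r_def power2_eq_square simp flip: exp_add)
  have q: "r\<^sup>2 < 1" using \<beta> by (simp flip: r(1))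
  have "exp (\<beta> / 2) = 1 / r" by (simp add: r_def exp_minus field_simps)
  then have "\<beta> \<le> 1 / r - r" using two_mult_le_exp_diff[of "\<beta> / 2"] \<beta> by (simp add: r_def)
  then have "\<beta> * r \<le> (1 / r - r) * r" using r(2) by (intro mult_right_mono) auto
  also have "\<dots> = 1 - r\<^sup>2" using r(2) by (simp add: field_simps power2_eq_square)
  finally have "(\<beta> * r)\<^sup>2 \<le> (1 - r\<^sup>2)\<^sup>2" using \<beta> r(2) by (intro power_mono) auto
  then have "r\<^sup>2 / (1 - r\<^sup>2)\<^sup>2 \<le> 1 / \<beta>\<^sup>2"
    using \<beta> q by (simp add: field_simps)
  moreover have "((1 + r\<^sup>2) / (1 - r\<^sup>2))\<^sup>2 = 1 + 4 * (r\<^sup>2 / (1 - r\<^sup>2)\<^sup>2)"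
  proof -
    have *: "(1 + r\<^sup>2)\<^sup>2 = (1 - r\<^sup>2)\<^sup>2 + 4 * r\<^sup>2" by (simp add: power2_eq_square algebra_simps)
    have "((1 + r\<^sup>2) / (1 - r\<^sup>2))\<^sup>2 = ((1 - r\<^sup>2)\<^sup>2 + 4 * r\<^sup>2) / (1 - r\<^sup>2)\<^sup>2"
      by (simp only: power_divide *)
    also have "\<dots> = (1 - r\<^sup>2)\<^sup>2 / (1 - r\<^sup>2)\<^sup>2 + 4 * (r\<^sup>2 / (1 - r\<^sup>2)\<^sup>2)"
      by (simp only: add_divide_distrib times_divide_eq_right)
    also have "(1 - r\<^sup>2)\<^sup>2 / (1 - r\<^sup>2)\<^sup>2 = 1" using q by simp
    finally show ?thesis .
  qed
  ultimately show "((1 + exp (- \<beta>)) / (1 - exp (- \<beta>)))\<^sup>2 \<le> 1 + 4 / \<beta>\<^sup>2" by (simp add: r(1))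
qed

lemma sum_power_le_geometric:
  fixes q :: real
  assumes "finite I" "0 \<le> q" "q < 1"
  shows "(\<Sum>i\<in>I. q ^ i) \<le> 1 / (1 - q)"
  using sum_le_suminf[of "\<lambda>i. q ^ i" I] assms by (simp add: suminf_geometric summable_geometric)

text \<open>The integers on either side of \<open>\<nu>\<close> contribute geometric series with
  ratio \<open>q\<close> and first terms \<open>x\<close> and \<open>y\<close>. Since
  \<open>x * y = q\<close> and both are at most 1, expanding
  \<open>(1 - x) * (1 - y) \<ge> 0\<close> gives \<open>x + y \<le> 1 + q\<close>; the worst case is
  an integral \<open>\<nu>\<close>.\<close>

lemma sum_exp_int_le:
  fixes \<beta> \<nu> :: real and K :: "int set"
  assumes \<beta>: "\<beta> > 0" and K: "finite K"
  shows "(\<Sum>k\<in>K. exp (- (\<beta> * \<bar>of_int k - \<nu>\<bar>))) \<le> (1 + exp (- \<beta>)) / (1 - exp (- \<beta>))"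
proof -
  define q where "q = exp (- \<beta>)"
  have q: "0 < q" "q < 1" using \<beta> by (auto simp: q_def)
  define c where "c = \<lfloor>\<nu>\<rfloor>"
  define x where "x = exp (- (\<beta> * (\<nu> - c)))"
  define y where "y = exp (- (\<beta> * (c + 1 - \<nu>)))"
  have c: "of_int c \<le> \<nu>" "\<nu> < of_int c + 1" by (auto simp: c_def)
  have xy: "x * y = q" by (simp add: x_def y_def q_def algebra_simps flip: exp_add)
  have "x \<le> 1" "y \<le> 1" using c \<beta> by (auto simp: x_def y_def)
  then have "0 \<le> (1 - x) * (1 - y)" by simp
  then have xyq: "x + y \<le> 1 + q" using xy by (simp add: algebra_simps)
  let ?K1 = "{k \<in> K. k \<le> c}" and ?K2 = "{k \<in> K. k > c}"
  have qpow: "exp (- (\<beta> * real n)) = q ^ n" for n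
    by (simp add: q_def mult.commute flip: exp_of_nat_mult)
  have "(\<Sum>k\<in>?K1. exp (- (\<beta> * \<bar>of_int k - \<nu>\<bar>))) = (\<Sum>k\<in>?K1. x * q ^ nat (c - k))"
  proof (intro sum.cong refl)
    fix k assume "k \<in> ?K1"
    then have k: "k \<le> c" by simp
    then have eq: "\<bar>of_int k - \<nu>\<bar> = (\<nu> - c) + real (nat (c - k))" using c by simp
    show "exp (- (\<beta> * \<bar>of_int k - \<nu>\<bar>)) = x * q ^ nat (c - k)"
      unfolding eq x_def qpow[symmetric] exp_add[symmetric] by (simp add: algebra_simps)
  qed
  also have "\<dots> = x * (\<Sum>i\<in>(\<lambda>k. nat (c - k)) ` ?K1. q ^ i)"
    by (subst sum.reindex) (auto simp: inj_on_def sum_distrib_left)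
  also have "\<dots> \<le> x * (1 / (1 - q))"
    using K q by (intro mult_left_mono sum_power_le_geometric) (auto simp: x_def)
  finally have 1: "(\<Sum>k\<in>?K1. exp (- (\<beta> * \<bar>of_int k - \<nu>\<bar>))) \<le> x / (1 - q)" by simp
  have "(\<Sum>k\<in>?K2. exp (- (\<beta> * \<bar>of_int k - \<nu>\<bar>))) = (\<Sum>k\<in>?K2. y * q ^ nat (k - c - 1))"
  proof (intro sum.cong refl)
    fix k assume "k \<in> ?K2"
    then have k: "c + 1 \<le> k" by simp
    then have "of_int c + 1 \<le> real_of_int k" by linarith
    then have eq: "\<bar>of_int k - \<nu>\<bar> = (c + 1 - \<nu>) + real (nat (k - c - 1))" using c k by simp
    show "exp (- (\<beta> * \<bar>of_int k - \<nu>\<bar>)) = y * q ^ nat (k - c - 1)"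
      unfolding eq y_def qpow[symmetric] exp_add[symmetric] by (simp add: algebra_simps)
  qed
  also have "\<dots> = y * (\<Sum>i\<in>(\<lambda>k. nat (k - c - 1)) ` ?K2. q ^ i)"
    by (subst sum.reindex) (auto simp: inj_on_def sum_distrib_left)
  also have "\<dots> \<le> y * (1 / (1 - q))"
    using K q by (intro mult_left_mono sum_power_le_geometric) (auto simp: y_def)
  finally have 2: "(\<Sum>k\<in>?K2. exp (- (\<beta> * \<bar>of_int k - \<nu>\<bar>))) \<le> y / (1 - q)" by simp
  have "(\<Sum>k\<in>K. exp (- (\<beta> * \<bar>of_int k - \<nu>\<bar>)))
     = (\<Sum>k\<in>?K1. exp (- (\<beta> * \<bar>of_int k - \<nu>\<bar>))) + (\<Sum>k\<in>?K2. exp (- (\<beta> * \<bar>of_int k - \<nu>\<bar>)))"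
    using K by (subst sum.union_disjoint[symmetric]) (auto intro!: sum.cong)
  also have "\<dots> \<le> (x + y) / (1 - q)" using 1 2 by (simp add: add_divide_distrib)
  also have "\<dots> \<le> (1 + q) / (1 - q)" using xyq q by (intro divide_right_mono) auto
  finally show ?thesis by (simp add: q_def)
qed

text \<open>The map from \<open>v\<close> to \<open>of_int h * v + c\<close> is injective into the
  integers and turns the rate \<open>\<alpha>\<close> into \<open>\<alpha> / \<bar>h\<bar>\<close>.
  As the square of \<open>h\<close> is at least 1, the factor \<open>\<bar>h\<bar>\<close> can be
  moved out of the square root.\<close>

lemma sum_exp_scaled_int_le:
  fixes \<alpha> \<mu> c :: real and h :: int
  assumes \<alpha>: "\<alpha> > 0" and V: "finite V" and h: "h \<noteq> 0" and int: "\<And>v. v \<in> V \<Longrightarrow> of_int h * v + c \<in> \<int>"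
  shows "(\<Sum>v\<in>V. exp (- (\<alpha> * \<bar>v - \<mu>\<bar>))) \<le> \<bar>of_int h\<bar> * sqrt (1 + 4 / \<alpha>\<^sup>2)"
proof -
  define \<beta> where "\<beta> = \<alpha> / \<bar>of_int h\<bar>"
  have \<beta>: "\<beta> > 0" using \<alpha> h by (simp add: \<beta>_def)
  define \<nu> where "\<nu> = of_int h * \<mu> + c"
  define k where "k v = \<lfloor>of_int h * v + c\<rfloor>" for v
  have k: "of_int (k v) = of_int h * v + c" if "v \<in> V" for v
    using int[OF that] by (auto simp: k_def elim: Ints_cases)
  have inj: "inj_on k V"
  proof (rule inj_onI)
    fix v w assume "v \<in> V" "w \<in> V" "k v = k w"
    then have "of_int h * v + c = of_int h * w + c" using k by metis
    then show "v = w" using h by simp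
  qed
  have "(\<Sum>v\<in>V. exp (- (\<alpha> * \<bar>v - \<mu>\<bar>))) = (\<Sum>v\<in>V. exp (- (\<beta> * \<bar>of_int (k v) - \<nu>\<bar>)))"
  proof (intro sum.cong refl)
    fix v assume "v \<in> V"
    then have "of_int (k v) - \<nu> = of_int h * (v - \<mu>)" using k by (simp add: \<nu>_def algebra_simps)
    then show "exp (- (\<alpha> * \<bar>v - \<mu>\<bar>)) = exp (- (\<beta> * \<bar>of_int (k v) - \<nu>\<bar>))"
      using h by (simp add: \<beta>_def abs_mult)
  qed
  also have "\<dots> = (\<Sum>l\<in>k ` V. exp (- (\<beta> * \<bar>of_int l - \<nu>\<bar>)))"
    using inj by (simp add: sum.reindex)
  also have "\<dots> \<le> (1 + exp (- \<beta>)) / (1 - exp (- \<beta>))"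
    using V by (intro sum_exp_int_le[OF \<beta>]) auto
  also have "\<dots> \<le> sqrt (1 + 4 / \<beta>\<^sup>2)" by (rule coth_le_sqrt[OF \<beta>])
  also have "\<dots> \<le> sqrt ((of_int h)\<^sup>2 * (1 + 4 / \<alpha>\<^sup>2))"
  proof (rule real_sqrt_le_mono)
    have "h\<^sup>2 \<ge> 1" using h by (simp add: int_one_le_iff_zero_less)
    then have "(of_int h)\<^sup>2 \<ge> (1 :: real)" by (metis of_int_1_le_iff of_int_power)
    then show "1 + 4 / \<beta>\<^sup>2 \<le> (of_int h)\<^sup>2 * (1 + 4 / \<alpha>\<^sup>2)"
      using h by (simp add: \<beta>_def power_divide distrib_left mult.commute)
  qed
  also have "\<dots> = \<bar>of_int h\<bar> * sqrt (1 + 4 / \<alpha>\<^sup>2)" by (simp add: real_sqrt_mult)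
  finally show ?thesis .
qed

text \<open>The points \<open>t\<close> with \<open>H t\<close> integral are summed one coordinate at a time, starting with the
  last: once the later coordinates are fixed, \<open>t i\<close> runs through a translate of \<open>\<int> / H i i\<close>.\<close>

lemma sum_exp_lattice_le:
  fixes H :: "nat \<Rightarrow> nat \<Rightarrow> int" and \<mu> :: "nat \<Rightarrow> real" and T :: "(nat \<Rightarrow> real) set"
  assumes \<alpha>: "\<alpha> > 0" and diag: "\<And>k. k < m \<Longrightarrow> H k k \<noteq> 0"
    and "d \<le> m" "finite T" "inj_on (\<lambda>t. restrict t {m - d..<m}) T"
    and "\<And>t k. t \<in> T \<Longrightarrow> m - d \<le> k \<Longrightarrow> k < m \<Longrightarrow> (\<Sum>l\<in>{k..<m}. of_int (H k l) * t l) \<in> \<int>"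
  shows "(\<Sum>t\<in>T. exp (- (\<alpha> * (\<Sum>k\<in>{m - d..<m}. \<bar>t k - \<mu> k\<bar>))))
    \<le> (\<Prod>k\<in>{m - d..<m}. \<bar>of_int (H k k)\<bar> * sqrt (1 + 4 / \<alpha>\<^sup>2))"
  using assms(3-)
proof (induction d arbitrary: T)
  case 0
  \<comment> \<open>All restrictions to the empty index set coincide, so injectivity leaves at most
    one point, of weight \<open>exp 0\<close>.\<close>
  have "card T \<le> 1"
  proof -
    have "\<forall>x\<in>T. \<forall>y\<in>T. x = y" using 0(3) by (auto simp: inj_on_def restrict_def)
    then show ?thesis using 0(2) by (simp add: card_le_Suc0_iff_eq)
  qed
  then show ?case by simp
next
  case (Suc d)
  define i where "i = m - Suc d"
  have i: "i < m" "m - d = Suc i" using Suc.prems(1) by (auto simp: i_def)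
  have ins: "{i..<m} = insert i {Suc i..<m}" using i by auto
  define tail where "tail t = restrict t {Suc i..<m}" for t :: "nat \<Rightarrow> real"
  define R where "R = tail ` T"
  let ?C = "\<bar>of_int (H i i)\<bar> * sqrt (1 + 4 / \<alpha>\<^sup>2)"
  let ?E = "\<lambda>t. exp (- (\<alpha> * (\<Sum>k\<in>{Suc i..<m}. \<bar>t k - \<mu> k\<bar>)))"
  have tail_E: "?E (tail t) = ?E t" for t by (simp add: tail_def)
  have IH: "(\<Sum>t\<in>R. ?E t) \<le> (\<Prod>k\<in>{Suc i..<m}. \<bar>of_int (H k k)\<bar> * sqrt (1 + 4 / \<alpha>\<^sup>2))"
    unfolding i(2)[symmetric]
  proof (rule Suc.IH)
    show "d \<le> m" "finite R" using Suc.prems by (auto simp: R_def)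
    show "inj_on (\<lambda>t. restrict t {m - d..<m}) R"
      by (auto simp: inj_on_def R_def tail_def i(2))
    fix t k assume t: "t \<in> R" "m - d \<le> k" "k < m"
    then obtain t' where t': "t' \<in> T" "t = tail t'" by (auto simp: R_def)
    have "(\<Sum>l\<in>{k..<m}. of_int (H k l) * t l) = (\<Sum>l\<in>{k..<m}. of_int (H k l) * t' l)"
      using t i by (intro sum.cong) (auto simp: t' tail_def)
    then show "(\<Sum>l\<in>{k..<m}. of_int (H k l) * t l) \<in> \<int>"
      using Suc.prems(4)[OF t'(1), of k] t i by (simp add: i_def)
  qed
  have fibre: "(\<Sum>t\<in>{t \<in> T. tail t = r}. exp (- (\<alpha> * \<bar>t i - \<mu> i\<bar>))) \<le> ?C" for r
  proof -
    let ?F = "{t \<in> T. tail t = r}"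
    have inj: "inj_on (\<lambda>t. t i) ?F"
    proof (rule inj_onI)
      fix t t' assume t: "t \<in> ?F" "t' \<in> ?F" "t i = t' i"
      have "restrict t {i..<m} = restrict t' {i..<m}"
      proof
        fix k
        have "tail t k = tail t' k" using t by simp
        then show "restrict t {i..<m} k = restrict t' {i..<m} k"
          using t(3) i by (cases "k = i") (auto simp: tail_def restrict_def split: if_splits)
      qed
      then show "t = t'" using Suc.prems(3) t unfolding i_def[symmetric] inj_on_def by blast
    qed
    have "(\<Sum>t\<in>?F. exp (- (\<alpha> * \<bar>t i - \<mu> i\<bar>)))
        = (\<Sum>v\<in>(\<lambda>t. t i) ` ?F. exp (- (\<alpha> * \<bar>v - \<mu> i\<bar>)))"
      using inj by (simp add: sum.reindex)
    also have "\<dots> \<le> ?C"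
    proof (rule sum_exp_scaled_int_le[OF \<alpha>])
      show "finite ((\<lambda>t. t i) ` ?F)" using Suc.prems(2) by simp
      show "H i i \<noteq> 0" using diag i by simp
      fix v assume "v \<in> (\<lambda>t. t i) ` ?F"
      then obtain t where t: "t \<in> T" "tail t = r" "v = t i" by auto
      have "(\<Sum>l\<in>{i..<m}. of_int (H i l) * t l) \<in> \<int>"
        using Suc.prems(4)[OF t(1), of i] i by (simp add: i_def)
      also have "(\<Sum>l\<in>{i..<m}. of_int (H i l) * t l)
          = of_int (H i i) * v + (\<Sum>l\<in>{Suc i..<m}. of_int (H i l) * r l)"
        unfolding ins using t by (auto simp: tail_def intro!: sum.cong)
      finally show "of_int (H i i) * v + (\<Sum>l\<in>{Suc i..<m}. of_int (H i l) * r l) \<in> \<int>" .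
    qed
    finally show ?thesis .
  qed
  have "(\<Sum>t\<in>T. exp (- (\<alpha> * (\<Sum>k\<in>{i..<m}. \<bar>t k - \<mu> k\<bar>))))
     = (\<Sum>t\<in>T. exp (- (\<alpha> * \<bar>t i - \<mu> i\<bar>)) * ?E t)"
    unfolding ins by (simp add: distrib_left flip: exp_add)
  also have "\<dots> = (\<Sum>r\<in>R. \<Sum>t\<in>{t \<in> T. tail t = r}. exp (- (\<alpha> * \<bar>t i - \<mu> i\<bar>)) * ?E t)"
    unfolding R_def using Suc.prems(2) by (rule sum.image_gen)
  also have "\<dots> = (\<Sum>r\<in>R. (\<Sum>t\<in>{t \<in> T. tail t = r}. exp (- (\<alpha> * \<bar>t i - \<mu> i\<bar>))) * ?E r)"
    unfolding sum_distrib_right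
  proof (intro sum.cong refl)
    fix r t assume "t \<in> {t \<in> T. tail t = r}"
    then have tr: "tail t = r" by simp
    have "?E t = ?E r" using tail_E[of t] by (simp only: tr)
    then show "exp (- (\<alpha> * \<bar>t i - \<mu> i\<bar>)) * ?E t = exp (- (\<alpha> * \<bar>t i - \<mu> i\<bar>)) * ?E r" by (rule arg_cong)
  qed
  also have "\<dots> \<le> (\<Sum>r\<in>R. ?C * ?E r)"
    by (intro sum_mono mult_right_mono fibre) auto
  also have "\<dots> = ?C * (\<Sum>r\<in>R. ?E r)" by (simp add: sum_distrib_left)
  also have "\<dots> \<le> ?C * (\<Prod>k\<in>{Suc i..<m}. \<bar>of_int (H k k)\<bar> * sqrt (1 + 4 / \<alpha>\<^sup>2))"
    using IH by (intro mult_left_mono) auto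
  also have "\<dots> = (\<Prod>k\<in>{i..<m}. \<bar>of_int (H k k)\<bar> * sqrt (1 + 4 / \<alpha>\<^sup>2))"
    unfolding ins by simp
  finally show ?case by (simp add: i_def)
qed

section \<open>Deviation of random subset sums\<close>

lemma sum_Pow_insert:
  assumes "finite S" "x \<notin> S"
  shows "(\<Sum>Y\<in>Pow (insert x S). F Y) = (\<Sum>Y\<in>Pow S. F Y + (F (insert x Y) :: real))"
proof -
  have "inj_on (insert x) (Pow S)" using assms by (auto simp: inj_on_def)
  then show ?thesis
    unfolding Pow_insert sum.distrib using assms
    by (subst sum.union_disjoint) (auto simp: sum.reindex)
qed

text \<open>For a uniformly random subset each element shifts the deviation by plus or minus half
  its value, independently of the others. Pairing \<open>Y\<close> with \<open>insert x Y\<close>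
  cancels the cross terms.\<close>

lemma subset_sum_variance:
  fixes T :: "'a \<Rightarrow> real"
  assumes "finite S"
  shows "(\<Sum>Y\<in>Pow S. (sum T Y - sum T S / 2)\<^sup>2) = 2 ^ card S * (\<Sum>j\<in>S. (T j)\<^sup>2) / 4"
  using assms
proof (induction S rule: finite_induct)
  case empty
  then show ?case by simp
next
  case (insert x S)
  have "(\<Sum>Y\<in>Pow (insert x S). (sum T Y - sum T (insert x S) / 2)\<^sup>2)
     = (\<Sum>Y\<in>Pow S. 2 * (sum T Y - sum T S / 2)\<^sup>2 + (T x)\<^sup>2 / 2)"
    unfolding sum_Pow_insert[OF insert.hyps]
  proof (intro sum.cong refl)
    fix Y assume "Y \<in> Pow S"
    then have "finite Y" "x \<notin> Y" using insert.hyps by (auto intro: finite_subset)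
    then show "(sum T Y - sum T (insert x S) / 2)\<^sup>2 + (sum T (insert x Y) - sum T (insert x S) / 2)\<^sup>2
       = 2 * (sum T Y - sum T S / 2)\<^sup>2 + (T x)\<^sup>2 / 2"
      using insert.hyps by (simp add: power2_eq_square field_simps)
  qed
  also have "\<dots> = 2 * (\<Sum>Y\<in>Pow S. (sum T Y - sum T S / 2)\<^sup>2) + 2 ^ card S * ((T x)\<^sup>2 / 2)"
    using insert.hyps by (simp add: sum.distrib card_Pow flip: sum_distrib_left)
  finally show ?case using insert by (simp add: field_simps)
qed

text \<open>The first moment follows from the second by summing
  \<open>2 * c * \<bar>d\<bar> \<le> d * d + c * c\<close> over all deviations \<open>d\<close>,
  where \<open>c\<close> is the bound on the standard deviation.\<close>

lemma subset_sum_deviation: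
  fixes T :: "'a \<Rightarrow> real"
  assumes S: "finite S" "card S > 0" and T: "\<And>j. j \<in> S \<Longrightarrow> \<bar>T j\<bar> \<le> 1"
  shows "(\<Sum>Y\<in>Pow S. \<bar>sum T Y - sum T S / 2\<bar>) \<le> 2 ^ card S * sqrt (card S) / 2"
proof -
  define c where "c = sqrt (card S) / 2"
  have c: "c > 0" "c\<^sup>2 = card S / 4" using S by (auto simp: c_def power_divide)
  have "2 * c * (\<Sum>Y\<in>Pow S. \<bar>sum T Y - sum T S / 2\<bar>)
     \<le> (\<Sum>Y\<in>Pow S. (sum T Y - sum T S / 2)\<^sup>2 + c\<^sup>2)"
    unfolding sum_distrib_left
  proof (intro sum_mono)
    fix Y
    have "0 \<le> (\<bar>sum T Y - sum T S / 2\<bar> - c)\<^sup>2" by simp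
    then show "2 * c * \<bar>sum T Y - sum T S / 2\<bar> \<le> (sum T Y - sum T S / 2)\<^sup>2 + c\<^sup>2"
      by (simp add: power2_diff mult_ac)
  qed
  also have "\<dots> = 2 ^ card S * (\<Sum>j\<in>S. (T j)\<^sup>2) / 4 + 2 ^ card S * c\<^sup>2"
    using S by (simp add: sum.distrib subset_sum_variance card_Pow)
  also have "\<dots> \<le> 2 ^ card S * card S / 4 + 2 ^ card S * c\<^sup>2"
  proof -
    have "(\<Sum>j\<in>S. (T j)\<^sup>2) \<le> (\<Sum>j\<in>S. 1)"
      using T by (intro sum_mono) (simp add: abs_square_le_1)
    then show ?thesis by simp
  qed
  also have "\<dots> = 2 * c * (2 ^ card S * c)" using c(2) by (simp add: power2_eq_square)
  finally have "(\<Sum>Y\<in>Pow S. \<bar>sum T Y - sum T S / 2\<bar>) \<le> 2 ^ card S * c" using c(1) by simp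
  then show ?thesis by (simp add: c_def)
qed

text \<open>Two estimates of the total weight \<open>exp (- L Y)\<close> of all subset sums: from
  below because \<open>L\<close> is at most \<open>m\<close> on average, from above because the sums
  are distinct points on which the triangular matrix \<open>H\<close> is integral.\<close>

lemma distinct_subset_sums_bound:
  fixes T :: "nat \<Rightarrow> nat \<Rightarrow> real" and H :: "nat \<Rightarrow> nat \<Rightarrow> int"
  assumes S: "finite S" "card S > 0" and T: "\<And>k j. k < m \<Longrightarrow> j \<in> S \<Longrightarrow> \<bar>T k j\<bar> \<le> 1"
    and diag: "\<And>k. k < m \<Longrightarrow> H k k \<noteq> 0"
    and int: "\<And>Y i. Y \<subseteq> S \<Longrightarrow> i < m \<Longrightarrow> (\<Sum>k\<in>{i..<m}. of_int (H i k) * sum (T k) Y) \<in> \<int>"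
    and inj: "\<And>Y Z. Y \<subseteq> S \<Longrightarrow> Z \<subseteq> S \<Longrightarrow> (\<And>k. k < m \<Longrightarrow> sum (T k) Y = sum (T k) Z) \<Longrightarrow> Y = Z"
  shows "exp (- real m) * 2 ^ card S \<le> (\<Prod>k<m. \<bar>of_int (H k k)\<bar>) * sqrt (1 + real (card S)) ^ m"
proof -
  let ?s = "card S"
  \<comment> \<open>The average deviation is at most \<open>sqrt ?s / 2\<close> per coordinate, so
    this rate makes the average of \<open>L\<close> at most \<open>m\<close>; it also turns
    \<open>4 / \<alpha>\<^sup>2\<close> into \<open>?s\<close>.\<close>
  define \<alpha> where "\<alpha> = 2 / sqrt ?s"
  have \<alpha>: "\<alpha> > 0" "4 / \<alpha>\<^sup>2 = ?s" using S by (auto simp: \<alpha>_def power_divide)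
  define \<mu> where "\<mu> k = sum (T k) S / 2" for k
  define t where "t Y = restrict (\<lambda>k. sum (T k) Y) {0..<m}" for Y
  define L where "L Y = \<alpha> * (\<Sum>k\<in>{0..<m}. \<bar>t Y k - \<mu> k\<bar>)" for Y
  have tk: "t Y k = sum (T k) Y" if "k < m" for Y k using that by (simp add: t_def)
  have inj_t: "inj_on t (Pow S)"
    using inj tk by (intro inj_onI) (metis PowD)
  have "(\<Sum>Y\<in>Pow S. L Y) = \<alpha> * (\<Sum>k\<in>{0..<m}. \<Sum>Y\<in>Pow S. \<bar>t Y k - \<mu> k\<bar>)"
    unfolding L_def sum_distrib_left[symmetric] by (subst sum.swap) simp
  also have "\<dots> \<le> \<alpha> * (\<Sum>k\<in>{0..<m}. 2 ^ ?s * sqrt ?s / 2)"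
  proof (intro mult_left_mono sum_mono)
    fix k assume "k \<in> {0..<m}"
    then show "(\<Sum>Y\<in>Pow S. \<bar>t Y k - \<mu> k\<bar>) \<le> 2 ^ ?s * sqrt ?s / 2"
      using subset_sum_deviation[OF S, of "T k"] T by (simp add: tk \<mu>_def)
  qed (use \<alpha> in simp)
  also have "\<dots> = m * 2 ^ ?s" using S by (auto simp: \<alpha>_def)
  finally have L: "(\<Sum>Y\<in>Pow S. L Y) \<le> m * 2 ^ ?s" .
  \<comment> \<open>Jensen's inequality, by way of the tangent of the exponential at \<open>-m\<close>.\<close>
  have "exp (- real m) * 2 ^ ?s \<le> exp (- real m) * (\<Sum>Y\<in>Pow S. 1 + m - L Y)"
    using L S by (simp add: sum_subtractf card_Pow distrib_left sum.distrib algebra_simps)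
  also have "\<dots> \<le> (\<Sum>Y\<in>Pow S. exp (- L Y))"
    unfolding sum_distrib_left
  proof (intro sum_mono)
    fix Y
    have "1 + m - L Y \<le> exp (m - L Y)"
      using exp_ge_add_one_self[of "m - L Y"] by linarith
    then have "exp (- real m) * (1 + m - L Y) \<le> exp (- real m) * exp (m - L Y)"
      by (intro mult_left_mono) auto
    then show "exp (- real m) * (1 + m - L Y) \<le> exp (- L Y)" by (simp flip: exp_add)
  qed
  also have "\<dots> = (\<Sum>u\<in>t ` Pow S. exp (- (\<alpha> * (\<Sum>k\<in>{m - m..<m}. \<bar>u k - \<mu> k\<bar>))))"
    using inj_t by (simp add: sum.reindex L_def)
  also have "\<dots> \<le> (\<Prod>k\<in>{m - m..<m}. \<bar>of_int (H k k)\<bar> * sqrt (1 + 4 / \<alpha>\<^sup>2))"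
  proof (rule sum_exp_lattice_le[where H = H, OF \<alpha>(1)])
    show "inj_on (\<lambda>u. restrict u {m - m..<m}) (t ` Pow S)"
      by (auto simp: inj_on_def t_def)
    fix u i assume u: "u \<in> t ` Pow S" "m - m \<le> i" "i < m"
    then obtain Y where Y: "Y \<subseteq> S" "u = t Y" by auto
    have "(\<Sum>k\<in>{i..<m}. of_int (H i k) * u k) = (\<Sum>k\<in>{i..<m}. of_int (H i k) * sum (T k) Y)"
      by (intro sum.cong) (auto simp: Y tk)
    then show "(\<Sum>k\<in>{i..<m}. of_int (H i k) * u k) \<in> \<int>" using int[OF Y(1) u(3)] by simp
  qed (use S diag in auto)
  also have "\<dots> = (\<Prod>k<m. \<bar>of_int (H k k)\<bar>) * sqrt (1 + real ?s) ^ m"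
    by (simp add: \<alpha>(2) prod.distrib atLeast0LessThan)
  finally show ?thesis .
qed

section \<open>Sparse integer optima\<close>

text \<open>The coordinates \<open>T\<close> of a column in the basis \<open>f\<close> are quotients
  of minors by a minor of maximal absolute value, hence at most 1. Multiplying by \<open>U\<close>
  turns the basis into the triangular \<open>H\<close>, on which column sums are integral and whose
  diagonal has absolute product \<open>Delta A\<close>.\<close>

lemma distinct_column_sums_bound:
  assumes A: "A \<in> carrier_mat m n" and mn: "m \<le> n"
    and f: "\<And>k. k < m \<Longrightarrow> f k < n" "\<bar>det (col_select A f)\<bar> = Delta A" "Delta A > 0"
    and S: "S \<subseteq> {..<n}" "card S > 0"
    and dist: "\<And>Y Z. Y \<subseteq> S \<Longrightarrow> Z \<subseteq> S \<Longrightarrow>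
      (\<And>i. i < m \<Longrightarrow> (\<Sum>j\<in>Y. A $$ (i, j)) = (\<Sum>j\<in>Z. A $$ (i, j))) \<Longrightarrow> Y = Z"
  shows "exp (- real m) * 2 ^ card S \<le> of_int (Delta A) * sqrt (1 + real (card S)) ^ m"
proof -
  let ?B = "col_select A f"
  let ?d = "real_of_int (det ?B)"
  have B: "?B \<in> carrier_mat m m" using A by simp
  have d: "det ?B \<noteq> 0" using f by auto
  obtain U where U: "U \<in> carrier_mat m m" "\<bar>det U\<bar> = 1" "upper_triangular (U * ?B)"
    using unimodular_triangularization[OF B] by blast
  have UB: "U * ?B \<in> carrier_mat m m" using U B by auto
  define H where "H i k = (U * ?B) $$ (i, k)" for i k
  define T where "T k j = det (col_select A (f(k := j))) / ?d" for k j
  have "det (U * ?B) = (\<Prod>k<m. H k k)"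
    unfolding det_upper_triangular[OF U(3) UB] prod_list_diag_prod H_def
    using U(1) by (simp add: atLeast0LessThan)
  moreover have "\<bar>det (U * ?B)\<bar> = Delta A"
    using U f(2) by (simp add: det_mult[OF U(1) B] abs_mult)
  ultimately have prodH: "(\<Prod>k<m. \<bar>H k k\<bar>) = Delta A" by (simp add: abs_prod)
  have finS: "finite S" using S(1) finite_subset by blast
  have col: "of_int (A $$ (i, j)) = (\<Sum>k<m. of_int (A $$ (i, f k)) * T k j)" if "i < m" "j \<in> S" for i j
  proof -
    have "?d * of_int (A $$ (i, j))
       = (\<Sum>k<m. of_int (det (col_select A (f(k := j)))) * of_int (A $$ (i, f k)))"
      using arg_cong[OF cramer_columns[OF A d, of i j], of real_of_int] that S by auto
    then have "of_int (A $$ (i, j))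
       = (\<Sum>k<m. of_int (det (col_select A (f(k := j)))) * of_int (A $$ (i, f k))) / ?d"
      using d by (simp add: field_simps)
    then show ?thesis by (simp add: T_def sum_divide_distrib mult.commute)
  qed
  have colsum: "of_int (\<Sum>j\<in>Y. A $$ (i, j)) = (\<Sum>k<m. of_int (A $$ (i, f k)) * sum (T k) Y)"
    if "i < m" "Y \<subseteq> S" for i Y
  proof -
    have "of_int (\<Sum>j\<in>Y. A $$ (i, j)) = (\<Sum>j\<in>Y. \<Sum>k<m. of_int (A $$ (i, f k)) * T k j)"
      using that by (auto simp: col intro!: sum.cong)
    also have "\<dots> = (\<Sum>k<m. \<Sum>j\<in>Y. of_int (A $$ (i, f k)) * T k j)" by (rule sum.swap)
    finally show ?thesis by (simp add: sum_distrib_left)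
  qed
  have "exp (- real m) * 2 ^ card S \<le> (\<Prod>k<m. \<bar>of_int (H k k)\<bar>) * sqrt (1 + real (card S)) ^ m"
  proof (rule distinct_subset_sums_bound[where H = H and T = T, OF finS S(2)])
    fix k j assume "k < m" "j \<in> S"
    then have "\<bar>det (col_select A (f(k := j)))\<bar> \<le> \<bar>det ?B\<bar>"
      unfolding f(2) using f(1) S by (intro abs_det_col_select_le_Delta[OF A mn]) auto
    then have "\<bar>real_of_int (det (col_select A (f(k := j))))\<bar> \<le> \<bar>?d\<bar>" by linarith
    then show "\<bar>T k j\<bar> \<le> 1" using d by (simp add: T_def abs_divide)
  next
    fix k assume "k < m"
    moreover have "(\<Prod>k<m. \<bar>H k k\<bar>) \<noteq> 0" using prodH f(3) by simp
    ultimately show "H k k \<noteq> 0" by simp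
  next
    fix Y i assume Y: "Y \<subseteq> S" and i: "i < m"
    have H: "H i k = (\<Sum>l<m. U $$ (i, l) * A $$ (l, f k))" if "k < m" for k
      using that i U A by (simp add: H_def scalar_prod_def col_select_def atLeast0LessThan)
    \<comment> \<open>Entries below the diagonal vanish, so the sum may run over all
      \<open>k\<close>; it then is row \<open>i\<close> of \<open>U\<close> times the integral
      column sum over \<open>Y\<close>.\<close>
    have "(\<Sum>k\<in>{i..<m}. of_int (H i k) * sum (T k) Y) = (\<Sum>k<m. of_int (H i k) * sum (T k) Y)"
      using U(3) UB i by (intro sum.mono_neutral_left) (auto simp: H_def upper_triangular_def)
    also have "\<dots> = (\<Sum>k<m. \<Sum>l<m. of_int (U $$ (i, l)) * (of_int (A $$ (l, f k)) * sum (T k) Y))"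
      by (intro sum.cong refl) (simp add: H sum_distrib_right mult.assoc)
    also have "\<dots> = (\<Sum>l<m. of_int (U $$ (i, l)) * (\<Sum>k<m. of_int (A $$ (l, f k)) * sum (T k) Y))"
      by (subst sum.swap) (simp add: sum_distrib_left)
    also have "\<dots> = (\<Sum>l<m. of_int (U $$ (i, l)) * of_int (\<Sum>j\<in>Y. A $$ (l, j)))"
      by (intro sum.cong refl) (simp only: colsum[OF _ Y] lessThan_iff)
    also have "\<dots> \<in> \<int>" by (intro Ints_sum Ints_mult Ints_of_int)
    finally show "(\<Sum>k\<in>{i..<m}. of_int (H i k) * sum (T k) Y) \<in> \<int>" .
  next
    fix Y Z assume YZ: "Y \<subseteq> S" "Z \<subseteq> S" and eq: "\<And>k. k < m \<Longrightarrow> sum (T k) Y = sum (T k) Z"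
    show "Y = Z"
    proof (rule dist[OF YZ])
      fix i assume i: "i < m"
      have "real_of_int (\<Sum>j\<in>Y. A $$ (i, j)) = real_of_int (\<Sum>j\<in>Z. A $$ (i, j))"
        unfolding colsum[OF i YZ(1)] colsum[OF i YZ(2)] using eq by (intro sum.cong) auto
      then show "(\<Sum>j\<in>Y. A $$ (i, j)) = (\<Sum>j\<in>Z. A $$ (i, j))" by (simp only: of_int_eq_iff)
    qed
  qed
  also have "(\<Prod>k<m. \<bar>real_of_int (H k k)\<bar>) = of_int (Delta A)"
    unfolding prodH[symmetric] by simp
  finally show ?thesis .
qed

text \<open>All subset sums lie between the sum \<open>lo\<close> of the negative values and
  \<open>lo\<close> plus the sum of all absolute values; this interval has room for at most
  \<open>int (card S) * D + 1\<close> integers.\<close>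

lemma distinct_int_subset_sums_bound:
  fixes a :: "'a \<Rightarrow> int"
  assumes S: "finite S" and a: "\<And>j. j \<in> S \<Longrightarrow> \<bar>a j\<bar> \<le> D" and inj: "inj_on (sum a) (Pow S)"
  shows "2 ^ card S \<le> int (card S) * D + 1"
proof -
  define lo where "lo = (\<Sum>j\<in>S. min (a j) 0)"
  have "sum a ` Pow S \<subseteq> {lo..lo + int (card S) * D}"
  proof (clarify)
    fix Y assume Y: "Y \<subseteq> S"
    have fY: "sum a Y = (\<Sum>j\<in>S. if j \<in> Y then a j else 0)"
      using S Y by (simp add: sum.If_cases Int_absorb1)
    have "lo \<le> sum a Y" unfolding lo_def fY by (intro sum_mono) auto
    moreover have "sum a Y - lo \<le> (\<Sum>j\<in>S. D)"
      unfolding lo_def fY sum_subtractf[symmetric]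
    proof (intro sum_mono)
      fix j assume "j \<in> S"
      then show "(if j \<in> Y then a j else 0) - min (a j) 0 \<le> D" using a[of j] by (auto simp: min_def)
    qed
    ultimately show "sum a Y \<in> {lo..lo + int (card S) * D}" by simp
  qed
  then have "card (sum a ` Pow S) \<le> card {lo..lo + int (card S) * D}" by (intro card_mono) auto
  then have "2 ^ card S \<le> nat (int (card S) * D + 1)"
    using inj S by (simp add: card_image card_Pow algebra_simps)
  then have "int (2 ^ card S) \<le> int (nat (int (card S) * D + 1))" by (simp only: of_nat_le_iff)
  moreover have "int (card S) * D \<ge> 0"
  proof (cases "S = {}")
    case False
    then obtain j where "j \<in> S" by auto
    then have "D \<ge> 0" using a[of j] by linarith
    then show ?thesis by simp
  qed simp
  ultimately show ?thesis by simp
qed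

lemma column_sum_single_row_bound:
  assumes A: "A \<in> carrier_mat 1 n" and n: "1 \<le> n" and S: "S \<subseteq> {..<n}"
    and dist: "\<And>Y Z. Y \<subseteq> S \<Longrightarrow> Z \<subseteq> S \<Longrightarrow>
      (\<And>i. i < 1 \<Longrightarrow> (\<Sum>j\<in>Y. A $$ (i, j)) = (\<Sum>j\<in>Z. A $$ (i, j))) \<Longrightarrow> Y = Z"
  shows "2 ^ card S \<le> int (card S) * Delta A + 1"
proof (rule distinct_int_subset_sums_bound[where a = "\<lambda>j. A $$ (0, j)"])
  show "finite S" using S finite_subset by blast
  show "inj_on (sum (\<lambda>j. A $$ (0, j))) (Pow S)"
    using dist by (auto intro!: inj_onI)
  fix j assume "j \<in> S"
  then have j: "j < n" using S by auto
  have M: "col_select A (\<lambda>_. j) \<in> carrier_mat 1 1" using A by simp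
  have "upper_triangular (col_select A (\<lambda>_. j))" using M by (auto simp: upper_triangular_def)
  from det_upper_triangular[OF this M] have "det (col_select A (\<lambda>_. j)) = A $$ (0, j)"
    using A M by (simp add: prod_list_diag_prod)
  then show "\<bar>A $$ (0, j)\<bar> \<le> Delta A"
    using abs_det_col_select_le_Delta[OF A n, of "\<lambda>_. j"] j by simp
qed

section \<open>Integer optima of minimal support\<close>

lemma ip_feasible_iff:
  assumes "A \<in> carrier_mat m n" "b \<in> carrier_vec m"
  shows "ip_feasible A b z \<longleftrightarrow> z \<in> carrier_vec n \<and> (\<forall>j<n. z $ j \<ge> 0)
    \<and> (\<forall>i<m. (\<Sum>j<n. A $$ (i, j) * z $ j) = b $ i)"
proof -
  have "A *\<^sub>v z = b \<longleftrightarrow> (\<forall>i<m. (\<Sum>j<n. A $$ (i, j) * z $ j) = b $ i)" if "z \<in> carrier_vec n"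
    using assms that by (auto simp: vec_eq_iff scalar_prod_def atLeast0LessThan)
  then show ?thesis using assms by (auto simp: ip_feasible_def)
qed

text \<open>Take an optimum of minimal support. Two subsets of it with equal column sums would
  differ by a kernel vector \<open>w\<close> with entries -1, 0 and 1; moving along \<open>w\<close>
  keeps the objective and eventually makes a coordinate of the support zero.\<close>

lemma sparse_ip_optimum:
  assumes A: "A \<in> carrier_mat m n" and b: "b \<in> carrier_vec m" and c: "c \<in> carrier_vec n"
    and feas: "\<exists>z. ip_feasible A b z" and bdd: "\<exists>M. \<forall>z. ip_feasible A b z \<longrightarrow> c \<bullet> z \<le> M"
  obtains z where "ip_optimal A b c z"
    "\<And>Y Z. Y \<subseteq> {j. j < n \<and> z $ j \<noteq> 0} \<Longrightarrow> Z \<subseteq> {j. j < n \<and> z $ j \<noteq> 0} \<Longrightarrow>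
      (\<And>i. i < m \<Longrightarrow> (\<Sum>j\<in>Y. A $$ (i, j)) = (\<Sum>j\<in>Z. A $$ (i, j))) \<Longrightarrow> Y = Z"
proof -
  obtain z0 M where z0: "ip_feasible A b z0" and M: "\<And>z. ip_feasible A b z \<Longrightarrow> c \<bullet> z \<le> M"
    using feas bdd by blast
  \<comment> \<open>The objective is integral and bounded by \<open>M\<close>, so its gap to
    \<open>M\<close> takes a least value, and this happens at an optimum.\<close>
  obtain z1 where z1: "ip_feasible A b z1"
    "\<And>z. ip_feasible A b z \<Longrightarrow> nat (M - c \<bullet> z1) \<le> nat (M - c \<bullet> z)"
    using ex_has_least_nat[of "ip_feasible A b" z0 "\<lambda>z. nat (M - c \<bullet> z)"] z0 by blast
  have "c \<bullet> z \<le> c \<bullet> z1" if "ip_feasible A b z" for z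
    using z1(2)[OF that] M[OF that] by simp
  then have "ip_optimal A b c z1" using z1(1) by (simp add: ip_optimal_def)
  then obtain z where z: "ip_optimal A b c z"
    and least: "\<And>z'. ip_optimal A b c z' \<Longrightarrow>
      card {j. j < n \<and> z $ j \<noteq> 0} \<le> card {j. j < n \<and> z' $ j \<noteq> 0}"
    using ex_has_least_nat[of "ip_optimal A b c" z1 "\<lambda>z. card {j. j < n \<and> z $ j \<noteq> 0}"] by blast
  define S where "S = {j. j < n \<and> z $ j \<noteq> 0}"
  note ff = ip_feasible_iff[OF A b]
  have zf: "ip_feasible A b z" and zopt: "\<And>z'. ip_feasible A b z' \<Longrightarrow> c \<bullet> z' \<le> c \<bullet> z"
    using z by (auto simp: ip_optimal_def)
  have z': "z \<in> carrier_vec n" "\<And>j. j < n \<Longrightarrow> z $ j \<ge> 0"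
    "\<And>i. i < m \<Longrightarrow> (\<Sum>j<n. A $$ (i, j) * z $ j) = b $ i" using zf ff by auto
  have zS: "z $ j \<ge> 1" if "j \<in> S" for j using z'(2)[of j] that by (auto simp: S_def)
  have zS0: "z $ j = 0" if "j < n" "j \<notin> S" for j using that by (auto simp: S_def)
  have cz: "c \<bullet> vec n (\<lambda>j. z $ j + t * w j) = c \<bullet> z + t * (\<Sum>j<n. c $ j * w j)" for t and w :: "nat \<Rightarrow> int"
    using c z'(1) by (simp add: scalar_prod_def atLeast0LessThan sum.distrib distrib_left
        sum_distrib_left mult.left_commute)
  have feasible: "ip_feasible A b (vec n (\<lambda>j. z $ j + t * w j))"
    if "\<And>i. i < m \<Longrightarrow> (\<Sum>j<n. A $$ (i, j) * w j) = 0" "\<And>j. j < n \<Longrightarrow> z $ j + t * w j \<ge> 0"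
    for t and w :: "nat \<Rightarrow> int"
    unfolding ff
  proof (intro conjI allI impI)
    fix i assume i: "i < m"
    have "(\<Sum>j<n. A $$ (i, j) * vec n (\<lambda>j. z $ j + t * w j) $ j)
       = (\<Sum>j<n. A $$ (i, j) * z $ j) + t * (\<Sum>j<n. A $$ (i, j) * w j)"
      by (simp add: sum.distrib distrib_left sum_distrib_left mult.left_commute)
    then show "(\<Sum>j<n. A $$ (i, j) * vec n (\<lambda>j. z $ j + t * w j) $ j) = b $ i"
      using that(1)[OF i] z'(3)[OF i] by simp
  qed (use that(2) in auto)
  have no_sign_vector: False
    if w: "\<And>i. i < m \<Longrightarrow> (\<Sum>j<n. A $$ (i, j) * w j) = 0" "\<And>j. w j \<in> {-1, 0, 1}"
      "\<And>j. j \<notin> S \<Longrightarrow> w j = 0" "w j0 = - 1" for w :: "nat \<Rightarrow> int" and j0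
  proof -
    have w_le: "z $ j + t * w j \<ge> 0" if "j < n" "t = 1 \<or> t = - 1" for j t
      using that w(2)[of j] w(3)[of j] zS[of j] z'(2)[of j] by (cases "j \<in> S") auto
    \<comment> \<open>All entries of \<open>z\<close> on \<open>S\<close> are at least 1, so steps
      in both directions stay feasible; optimality of \<open>z\<close> then forces the objective to
      be constant along \<open>w\<close>.\<close>
    have "c \<bullet> vec n (\<lambda>j. z $ j + t * w j) \<le> c \<bullet> z" if "t = 1 \<or> t = - 1" for t
      using that by (intro zopt feasible w(1) w_le) auto
    from this[of 1] this[of "- 1"] have cw: "(\<Sum>j<n. c $ j * w j) = 0" unfolding cz by simp
    define N where "N = {j \<in> S. w j = - 1}"
    have j0: "j0 \<in> N" using w(3)[of j0] w(4) by (auto simp: N_def)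
    have finN: "finite N" by (simp add: N_def S_def)
    \<comment> \<open>The longest step along \<open>w\<close> that keeps all entries nonnegative; it
      makes the entry at \<open>j1\<close> zero.\<close>
    define t where "t = Min ((\<lambda>j. z $ j) ` N)"
    have "t \<in> (\<lambda>j. z $ j) ` N" unfolding t_def using finN j0 by (intro Min_in) auto
    then obtain j1 where j1: "j1 \<in> N" "t = z $ j1" by auto
    have tle: "t \<le> z $ j" if "j \<in> N" for j unfolding t_def using finN that by auto
    have t: "t \<ge> 1" using j1 zS by (auto simp: N_def)
    let ?z = "vec n (\<lambda>j. z $ j + t * w j)"
    have "ip_feasible A b ?z"
    proof (intro feasible w(1))
      fix j assume j: "j < n"
      have "j \<in> N \<or> w j \<ge> 0" using w(2)[of j] w(3)[of j] by (cases "j \<in> S") (auto simp: N_def)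
      then consider "j \<in> N" | "w j \<ge> 0" by blast
      then show "z $ j + t * w j \<ge> 0"
        using tle[of j] t z'(2)[OF j] by cases (auto simp: N_def)
    qed
    moreover have "c \<bullet> ?z = c \<bullet> z" unfolding cz cw by simp
    ultimately have "ip_optimal A b c ?z" using zopt by (auto simp: ip_optimal_def)
    from least[OF this] have "card S \<le> card {j. j < n \<and> ?z $ j \<noteq> 0}" by (simp add: S_def)
    moreover have "card {j. j < n \<and> ?z $ j \<noteq> 0} < card S"
    proof (rule psubset_card_mono)
      show "finite S" by (simp add: S_def)
      have "{j. j < n \<and> ?z $ j \<noteq> 0} \<subseteq> S" using w(3) zS0 by force
      moreover have "j1 \<in> S" "j1 \<notin> {j. j < n \<and> ?z $ j \<noteq> 0}" using j1 by (auto simp: N_def)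
      ultimately show "{j. j < n \<and> ?z $ j \<noteq> 0} \<subset> S" by blast
    qed
    ultimately show False by simp
  qed
  \<comment> \<open>An element of \<open>Z\<close> outside \<open>Y\<close> supplies the entry -1
    that limits the step. The other inclusion follows by exchanging the two sets.\<close>
  have le: "Z \<subseteq> Y" if YZ: "Y \<subseteq> S" "Z \<subseteq> S"
    and eq: "\<And>i. i < m \<Longrightarrow> (\<Sum>j\<in>Y. A $$ (i, j)) = (\<Sum>j\<in>Z. A $$ (i, j))" for Y Z
  proof (rule ccontr)
    assume "\<not> Z \<subseteq> Y"
    then obtain j0 where j0: "j0 \<in> Z" "j0 \<notin> Y" by auto
    define w :: "nat \<Rightarrow> int" where "w j = of_bool (j \<in> Y) - of_bool (j \<in> Z)" for j
    have restr: "(\<Sum>j<n. A $$ (i, j) * of_bool (j \<in> X)) = (\<Sum>j\<in>X. A $$ (i, j))" if "X \<subseteq> S" for i X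
    proof -
      have "X \<subseteq> {..<n}" using that by (auto simp: S_def)
      then show ?thesis by (simp add: Int_absorb1)
    qed
    show False
    proof (rule no_sign_vector[of w j0])
      fix i assume "i < m"
      then show "(\<Sum>j<n. A $$ (i, j) * w j) = 0"
        unfolding w_def right_diff_distrib sum_subtractf restr[OF YZ(1)] restr[OF YZ(2)] using eq by simp
    qed (use YZ j0 in \<open>auto simp: w_def\<close>)
  qed
  show ?thesis
  proof (rule that[OF z])
    fix Y Z assume "Y \<subseteq> {j. j < n \<and> z $ j \<noteq> 0}" "Z \<subseteq> {j. j < n \<and> z $ j \<noteq> 0}"
      and eq: "\<And>i. i < m \<Longrightarrow> (\<Sum>j\<in>Y. A $$ (i, j)) = (\<Sum>j\<in>Z. A $$ (i, j))"
    then have YZ: "Y \<subseteq> S" "Z \<subseteq> S" by (simp_all add: S_def)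
    show "Y = Z" using le[OF YZ eq] le[OF YZ(2,1) eq[symmetric]] by (rule equalityI[rotated])
  qed
qed

section \<open>Proximity\<close>

lemma lp_feasible_iff:
  assumes "A \<in> carrier_mat m n" "b \<in> carrier_vec m"
  shows "lp_feasible A b x \<longleftrightarrow> x \<in> carrier_vec n \<and> (\<forall>j<n. x $ j \<ge> 0)
    \<and> (\<forall>i<m. (\<Sum>j<n. of_int (A $$ (i, j)) * x $ j) = of_int (b $ i))"
proof -
  have "map_mat real_of_int A *\<^sub>v x = map_vec real_of_int b
      \<longleftrightarrow> (\<forall>i<m. (\<Sum>j<n. of_int (A $$ (i, j)) * x $ j) = of_int (b $ i))" if "x \<in> carrier_vec n"
    using assms that by (auto simp: vec_eq_iff scalar_prod_def atLeast0LessThan)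
  then show ?thesis using assms by (auto simp: lp_feasible_def)
qed

lemma lp_feasible_add_ker:
  assumes A: "A \<in> carrier_mat m n" and b: "b \<in> carrier_vec m" and x: "lp_feasible A b x"
    and u: "u \<in> ker A" and nonneg: "\<And>j. j < n \<Longrightarrow> x $ j + t * u j \<ge> 0"
  shows "lp_feasible A b (vec n (\<lambda>j. x $ j + t * u j))"
  unfolding lp_feasible_iff[OF A b]
proof (intro conjI allI impI)
  fix i assume i: "i < m"
  have "(\<Sum>j<n. of_int (A $$ (i, j)) * vec n (\<lambda>j. x $ j + t * u j) $ j)
      = (\<Sum>j<n. of_int (A $$ (i, j)) * x $ j) + t * (\<Sum>j<n. of_int (A $$ (i, j)) * u j)"
    by (simp add: sum.distrib distrib_left sum_distrib_left mult.left_commute)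
  also have "(\<Sum>j<n. of_int (A $$ (i, j)) * u j) = 0" using u A i by (auto simp: ker_def)
  finally show "(\<Sum>j<n. of_int (A $$ (i, j)) * vec n (\<lambda>j. x $ j + t * u j) $ j) = of_int (b $ i)"
    using x i by (simp add: lp_feasible_iff[OF A b])
qed (use nonneg in auto)

text \<open>A nonzero kernel vector on the support could be added and subtracted with a small factor
  \<open>e\<close>, making the vertex the midpoint of two different feasible points.\<close>

lemma lp_vertex_indep_cols:
  assumes A: "A \<in> carrier_mat m n" and b: "b \<in> carrier_vec m" and x: "lp_vertex A b x"
  shows "indep_cols A {j. j < n \<and> x $ j \<noteq> 0}"
  unfolding indep_cols_def
proof (intro ballI impI)
  fix u assume u: "u \<in> ker A" "supp u \<subseteq> {j. j < n \<and> x $ j \<noteq> 0}"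
  have xf: "lp_feasible A b x" using x by (simp add: lp_vertex_def)
  have x': "x \<in> carrier_vec n" "\<And>j. j < n \<Longrightarrow> x $ j \<ge> 0" using xf lp_feasible_iff[OF A b] by auto
  show "u = (\<lambda>_. 0)"
  proof (rule ccontr)
    assume "u \<noteq> (\<lambda>_. 0)"
    then obtain j0 where j0: "u j0 \<noteq> 0" by auto
    have fin: "finite (supp u)" by (rule ker_finite_supp[OF A u(1)])
    define e where "e = Min ((\<lambda>j. x $ j / \<bar>u j\<bar>) ` supp u)"
    have "e \<in> (\<lambda>j. x $ j / \<bar>u j\<bar>) ` supp u" unfolding e_def using fin j0 by (intro Min_in) auto
    then obtain j1 where j1: "u j1 \<noteq> 0" "e = x $ j1 / \<bar>u j1\<bar>" by auto
    then have e: "e > 0" using u(2) x'(2)[of j1] by (auto simp: less_le)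
    have le: "e * \<bar>u j\<bar> \<le> x $ j" if "j < n" for j
    proof (cases "u j = 0")
      case True
      then show ?thesis using x'(2)[OF that] by simp
    next
      case False
      then have "e \<le> x $ j / \<bar>u j\<bar>" unfolding e_def using fin by auto
      then show ?thesis using False by (simp add: pos_le_divide_eq)
    qed
    have bnd: "\<bar>e * u j\<bar> \<le> x $ j" if "j < n" for j using le[OF that] e by (simp add: abs_mult)
    let ?y = "vec n (\<lambda>j. x $ j + e * u j)" and ?w = "vec n (\<lambda>j. x $ j + (- e) * u j)"
    have vertexD: "y = w" if "lp_feasible A b y" "lp_feasible A b w" "0 < t" "t < 1"
      "x = t \<cdot>\<^sub>v y + (1 - t) \<cdot>\<^sub>v w" for y w t
      using x that unfolding lp_vertex_def by blast
    have "?y = ?w"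
    proof (rule vertexD[of _ _ "1/2"])
      show "lp_feasible A b ?y" "lp_feasible A b ?w"
        using bnd by (intro lp_feasible_add_ker[OF A b xf u(1)]; force simp: abs_le_iff)+
      show "x = (1/2) \<cdot>\<^sub>v ?y + (1 - 1/2) \<cdot>\<^sub>v ?w"
        using x'(1) by (intro eq_vecI) (auto simp: field_simps)
    qed auto
    then have "?y $ j0 = ?w $ j0" by (rule arg_cong)
    moreover have "j0 < n" using u(2) j0 by auto
    ultimately show False using e j0 by simp
  qed
qed

text \<open>The vector \<open>z - x\<close> is a conformal sum of \<open>N\<close> circuits, and
  subtracting the integral parts of the multipliers from \<open>z\<close> leaves fractional parts
  below 1. Each circuit has norm at most \<open>(m + 1) * Delta A\<close>. Independence of the
  support of the vertex gives \<open>N \<le> card Z\<close>.\<close>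

lemma l1_distance_bound:
  assumes A: "A \<in> carrier_mat m n" and mn: "m \<le> n" and b: "b \<in> carrier_vec m" and c: "c \<in> carrier_vec n"
    and ex: "\<exists>f. (\<forall>k<m. f k < n) \<and> det (col_select A f) \<noteq> 0" and D: "Delta A > 0"
    and xv: "lp_vertex A b x" and xo: "lp_optimal A b c x" and zo: "ip_optimal A b c z"
  shows "\<exists>y. ip_optimal A b c y \<and> ((\<Sum>j<n. \<bar>of_int (y $ j) - x $ j\<bar>) = 0 \<or>
    (\<Sum>j<n. \<bar>of_int (y $ j) - x $ j\<bar>) < real (card {j. j < n \<and> z $ j \<noteq> 0}) * (real (m + 1) * of_int (Delta A)))"
proof -
  note lf = lp_feasible_iff[OF A b] and pf = ip_feasible_iff[OF A b]
  have dims: "dim_row A = m" "dim_col A = n" using A by auto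
  have xf: "lp_feasible A b x" using xv by (simp add: lp_vertex_def)
  have x: "x \<in> carrier_vec n" "\<And>j. j < n \<Longrightarrow> x $ j \<ge> 0"
    "\<And>i. i < m \<Longrightarrow> (\<Sum>j<n. of_int (A $$ (i, j)) * x $ j) = of_int (b $ i)" using xf lf by auto
  have zf: "ip_feasible A b z" using zo by (simp add: ip_optimal_def)
  have z: "z \<in> carrier_vec n" "\<And>j. j < n \<Longrightarrow> z $ j \<ge> 0"
    "\<And>i. i < m \<Longrightarrow> (\<Sum>j<n. A $$ (i, j) * z $ j) = b $ i" using zf pf by auto
  define v where "v j = (if j < n then of_int (z $ j) - x $ j else 0)" for j
  define S where "S = {j. j < n \<and> x $ j \<noteq> 0}"
  define Z where "Z = {j. j < n \<and> z $ j \<noteq> 0}"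
  define N where "N = card (Z \<union> S - S)"
  have fin: "finite Z" "finite S" by (auto simp: Z_def S_def)
  have NZ: "N \<le> card Z" unfolding N_def using fin by (intro card_mono) auto
  have vk: "v \<in> ker A"
    unfolding ker_def dims
  proof (intro CollectI conjI allI impI)
    fix i assume i: "i < m"
    have "(\<Sum>j<n. of_int (A $$ (i, j)) * v j)
       = of_int (\<Sum>j<n. A $$ (i, j) * z $ j) - (\<Sum>j<n. of_int (A $$ (i, j)) * x $ j)"
      by (simp add: v_def right_diff_distrib sum_subtractf)
    then show "(\<Sum>j<n. of_int (A $$ (i, j)) * v j) = 0" using x(3)[OF i] z(3)[OF i] by simp
  qed (simp add: v_def)
  have vs: "supp v \<subseteq> Z \<union> S" by (auto simp: v_def Z_def S_def split: if_splits)
  obtain \<nu> and g :: "nat \<Rightarrow> nat \<Rightarrow> int" where dec: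
    "\<And>i. i < N \<Longrightarrow> \<nu> i \<ge> 0 \<and> (\<lambda>j. of_int (g i j)) \<in> ker A
      \<and> conformal (\<lambda>j. of_int (g i j)) v \<and> (\<forall>j. \<bar>g i j\<bar> \<le> Delta A) \<and> card {j. g i j \<noteq> 0} \<le> m + 1"
    and vsum: "\<And>j. v j = (\<Sum>i<N. \<nu> i * of_int (g i j))"
    using conformal_decomposition[OF A mn ex vk vs finite_UnI[OF fin] Un_upper2
        lp_vertex_indep_cols[OF A b xv, folded S_def] N_def[symmetric]] by blast
  have gk: "(\<lambda>j. real_of_int (g i j)) \<in> ker A" if "i < N" for i using dec[OF that] by blast
  have \<nu>0: "\<nu> i \<ge> 0" if "i < N" for i using dec[OF that] by blast
  have gpos: "g i j \<ge> 0" if "i < N" "v j \<ge> 0" for i j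
    using dec[OF that(1)] that(2) unfolding conformal_def by (metis not_less of_int_0_le_iff)
  have gneg: "g i j \<le> 0" if "i < N" "v j \<le> 0" for i j
    using dec[OF that(1)] that(2) unfolding conformal_def by (metis not_less of_int_le_0_iff)
  define r where "r j = (\<Sum>i<N. \<lfloor>\<nu> i\<rfloor> * g i j)" for j
  define y where "y = vec n (\<lambda>j. z $ j - r j)"
  have yx: "of_int (y $ j) - x $ j = (\<Sum>i<N. frac (\<nu> i) * of_int (g i j))" if "j < n" for j
  proof -
    have "of_int (y $ j) - x $ j = v j - (\<Sum>i<N. of_int \<lfloor>\<nu> i\<rfloor> * of_int (g i j))"
      using that by (simp add: y_def r_def v_def)
    then show ?thesis by (simp add: vsum frac_def left_diff_distrib sum_subtractf)
  qed
  \<comment> \<open>By conformality all terms at \<open>j\<close> have the sign of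
    \<open>v j\<close>: if it is nonnegative, \<open>y $ j\<close> is at least \<open>x $ j\<close>,
    otherwise at least \<open>z $ j\<close>.\<close>
  have y0: "y $ j \<ge> 0" if j: "j < n" for j
  proof (cases "v j \<ge> 0")
    case True
    then have "(\<Sum>i<N. frac (\<nu> i) * of_int (g i j)) \<ge> 0"
      using gpos by (intro sum_nonneg mult_nonneg_nonneg) auto
    then have "real_of_int (y $ j) \<ge> 0" using yx[OF j] x(2)[OF j] by linarith
    then show ?thesis by simp
  next
    case False
    then have "r j \<le> 0" unfolding r_def
      using gneg \<nu>0 by (intro sum_nonpos mult_nonneg_nonpos) auto
    then show ?thesis using z(2)[OF j] j by (simp add: y_def)
  qed
  have gkI: "(\<Sum>j<n. A $$ (l, j) * g i j) = 0" if "l < m" "i < N" for l i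
  proof -
    have "real_of_int (\<Sum>j<n. A $$ (l, j) * g i j) = 0" using gk[OF that(2)] that(1) by (simp add: ker_def dims)
    then show ?thesis by (simp only: of_int_eq_0_iff)
  qed
  have swap: "(\<Sum>j<n. a j * r j) = (\<Sum>i<N. \<lfloor>\<nu> i\<rfloor> * (\<Sum>j<n. a j * g i j))" for a
    unfolding r_def sum_distrib_left by (subst sum.swap) (simp add: mult.left_commute)
  have "(\<Sum>j<n. A $$ (l, j) * y $ j) = b $ l" if l: "l < m" for l
  proof -
    have "(\<Sum>j<n. A $$ (l, j) * y $ j) = b $ l - (\<Sum>j<n. A $$ (l, j) * r j)"
      by (simp add: y_def right_diff_distrib sum_subtractf z(3)[OF l])
    also have "(\<Sum>j<n. A $$ (l, j) * r j) = 0" unfolding swap by (simp add: gkI[OF l])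
    finally show ?thesis by simp
  qed
  then have yf: "ip_feasible A b y" unfolding pf using y0 by (simp add: y_def)
  \<comment> \<open>By conformality, adding one term of the decomposition to \<open>x\<close> stays
    between \<open>x\<close> and \<open>z\<close> in each coordinate, hence feasible. Optimality of
    \<open>x\<close> then shows that removing circuits from \<open>z\<close> cannot lower the
    objective.\<close>
  have cg: "\<lfloor>\<nu> i\<rfloor> * (\<Sum>j<n. c $ j * g i j) \<le> 0" if i: "i < N" for i
  proof (cases "\<nu> i = 0")
    case False
    then have \<nu>: "\<nu> i > 0" using \<nu>0[OF i] by simp
    have "lp_feasible A b (vec n (\<lambda>j. x $ j + \<nu> i * of_int (g i j)))"
    proof (rule lp_feasible_add_ker[OF A b xf gk[OF i]])
      fix j assume j: "j < n"
      show "x $ j + \<nu> i * of_int (g i j) \<ge> 0"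
      proof (cases "g i j \<ge> 0")
        case True
        then show ?thesis using \<nu> x(2)[OF j] by simp
      next
        case False
        then have vj: "v j \<le> 0" using gpos[OF i, of j] by linarith
        have "v j = \<nu> i * of_int (g i j) + (\<Sum>l\<in>{..<N} - {i}. \<nu> l * of_int (g l j))"
          unfolding vsum using i by (subst sum.remove[of _ i]) auto
        moreover have "(\<Sum>l\<in>{..<N} - {i}. \<nu> l * of_int (g l j)) \<le> 0"
          using gneg[OF _ vj] \<nu>0 by (intro sum_nonpos mult_nonneg_nonpos) auto
        ultimately have "x $ j + \<nu> i * of_int (g i j) \<ge> x $ j + v j" by linarith
        then show ?thesis using z(2)[OF j] j by (simp add: v_def)
      qed
    qed
    then have "map_vec real_of_int c \<bullet> vec n (\<lambda>j. x $ j + \<nu> i * of_int (g i j)) \<le> map_vec real_of_int c \<bullet> x"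
      using xo by (simp add: lp_optimal_def)
    moreover have "map_vec real_of_int c \<bullet> vec n (\<lambda>j. x $ j + \<nu> i * of_int (g i j))
       = map_vec real_of_int c \<bullet> x + \<nu> i * of_int (\<Sum>j<n. c $ j * g i j)"
      using c x(1) by (simp add: scalar_prod_def atLeast0LessThan sum.distrib distrib_left
        sum_distrib_left mult.left_commute)
    ultimately have "\<nu> i * of_int (\<Sum>j<n. c $ j * g i j) \<le> 0" by linarith
    then have "real_of_int (\<Sum>j<n. c $ j * g i j) \<le> 0" using \<nu> by (simp only: mult_le_0_iff) linarith
    then have "(\<Sum>j<n. c $ j * g i j) \<le> 0" by (simp only: of_int_le_0_iff)
    then show ?thesis using \<nu> by (intro mult_nonneg_nonpos) auto
  qed simp
  have "c \<bullet> y = c \<bullet> z - (\<Sum>j<n. c $ j * r j)"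
    using c z(1) by (simp add: y_def scalar_prod_def atLeast0LessThan right_diff_distrib sum_subtractf)
  moreover have "(\<Sum>j<n. c $ j * r j) \<le> 0" unfolding swap using cg by (intro sum_nonpos) auto
  ultimately have "c \<bullet> z \<le> c \<bullet> y" by simp
  then have yo: "ip_optimal A b c y" using zo yf by (force simp: ip_optimal_def)
  let ?D = "real (m + 1) * real_of_int (Delta A)"
  have gsum: "(\<Sum>j<n. \<bar>real_of_int (g i j)\<bar>) \<le> ?D" if i: "i < N" for i
  proof -
    let ?G = "{j. g i j \<noteq> 0}"
    have G: "?G \<subseteq> {..<n}" using ker_supp[OF A gk[OF i]] by auto
    have "(\<Sum>j<n. \<bar>real_of_int (g i j)\<bar>) = (\<Sum>j\<in>?G. \<bar>real_of_int (g i j)\<bar>)"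
      using G by (intro sum.mono_neutral_right) auto
    also have "\<dots> \<le> (\<Sum>j\<in>?G. real_of_int (Delta A))"
    proof (intro sum_mono)
      fix j
      have "\<bar>g i j\<bar> \<le> Delta A" using dec[OF i] by blast
      then show "\<bar>real_of_int (g i j)\<bar> \<le> real_of_int (Delta A)" by linarith
    qed
    also have "\<dots> = card ?G * real_of_int (Delta A)" by simp
    also have "\<dots> \<le> ?D"
    proof (intro mult_right_mono)
      have "card ?G \<le> m + 1" using dec[OF i] by blast
      then show "real (card ?G) \<le> real (m + 1)" by (simp only: of_nat_le_iff)
    qed (use D in simp)
    finally show ?thesis .
  qed
  have "(\<Sum>j<n. \<bar>of_int (y $ j) - x $ j\<bar>) \<le> (\<Sum>j<n. \<Sum>i<N. frac (\<nu> i) * \<bar>real_of_int (g i j)\<bar>)"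
  proof (intro sum_mono)
    fix j assume "j \<in> {..<n}"
    then have "\<bar>of_int (y $ j) - x $ j\<bar> \<le> (\<Sum>i<N. \<bar>frac (\<nu> i) * of_int (g i j)\<bar>)"
      using yx[of j] by simp
    then show "\<bar>of_int (y $ j) - x $ j\<bar> \<le> (\<Sum>i<N. frac (\<nu> i) * \<bar>real_of_int (g i j)\<bar>)"
      by (simp add: abs_mult)
  qed
  also have "\<dots> = (\<Sum>i<N. frac (\<nu> i) * (\<Sum>j<n. \<bar>real_of_int (g i j)\<bar>))"
    by (subst sum.swap) (simp add: sum_distrib_left)
  also have "\<dots> \<le> (\<Sum>i<N. frac (\<nu> i) * ?D)"
    using gsum by (intro sum_mono mult_left_mono) auto
  finally have le: "(\<Sum>j<n. \<bar>of_int (y $ j) - x $ j\<bar>) \<le> (\<Sum>i<N. frac (\<nu> i) * ?D)" .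
  have D0: "?D > 0" using D by simp
  show ?thesis
  proof (intro exI[of _ y] conjI yo)
    show "(\<Sum>j<n. \<bar>of_int (y $ j) - x $ j\<bar>) = 0 \<or>
      (\<Sum>j<n. \<bar>of_int (y $ j) - x $ j\<bar>) < real (card {j. j < n \<and> z $ j \<noteq> 0}) * ?D"
    \<comment> \<open>The strict comparison needs at least one circuit; without any, the distance is
      zero, which explains the disjunction.\<close>
    proof (cases "N = 0")
      case True
      then show ?thesis using le by (simp add: sum_nonneg order_antisym)
    next
      case False
      have "(\<Sum>i<N. frac (\<nu> i) * ?D) < (\<Sum>i<N. 1 * ?D)"
        using False D0 by (intro sum_strict_mono mult_strict_right_mono frac_lt_1) auto
      also have "\<dots> = N * ?D" by simp
      also have "\<dots> \<le> card Z * ?D" using NZ D0 by (intro mult_right_mono) auto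
      finally show ?thesis using le by (simp add: Z_def)
    qed
  qed
qed

section \<open>From the counting inequalities to a logarithmic support bound\<close>

text \<open>From \<open>s = 4\<close> on the cube at most doubles in each step; smaller values are
  checked directly. Equality holds at \<open>s = 3\<close>.\<close>

lemma cube_le_eight_mult_power2: "(s + 1) ^ 3 \<le> 8 * 2 ^ s" for s :: nat
proof -
  consider "s = 0" | "s = 1" | "s = 2" | "s = 3" | "s \<ge> 4" by linarith
  then show ?thesis
  proof cases
    case 5
    then show ?thesis
    proof (induction s rule: dec_induct)
      case (step s)
      have "(Suc s + 1) ^ 3 \<le> 2 * (s + 1) ^ 3"
      proof -
        have "16 \<le> s * s" using mult_le_mono[OF step(1) step(1)] by simp
        then have "16 * s \<le> s * s * s" by (rule mult_le_mono1)
        moreover have "(Suc s + 1) ^ 3 = s * s * s + 6 * (s * s) + 12 * s + 8"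
          and "2 * (s + 1) ^ 3 = 2 * (s * s * s) + 6 * (s * s) + 6 * s + 2"
          by (simp_all add: power3_eq_cube algebra_simps)
        ultimately show ?thesis using step(1) by linarith
      qed
      then show ?case using step by simp
    qed simp
  qed (auto simp: power3_eq_cube)
qed

text \<open>Cubing \<open>2 ^ s \<le> (s + 1) * D\<close> and absorbing the cube of
  \<open>s + 1\<close> into \<open>8 * 2 ^ s\<close> leaves
  \<open>4 ^ s \<le> (2 * D) ^ 3\<close>.\<close>

lemma support_size_single_row:
  fixes D :: int
  assumes D: "D \<ge> 1" and s: "2 ^ s \<le> int s * D + 1"
  shows "2 * real s \<le> 3 * log 2 (2 * real_of_int D)"
proof -
  have "2 ^ s \<le> (int s + 1) * D" using s D by (simp add: algebra_simps)
  then have "(2 ^ s) ^ 3 \<le> ((int s + 1) * D) ^ 3" by (intro power_mono) auto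
  also have "\<dots> = (int s + 1) ^ 3 * D ^ 3" by (simp add: power_mult_distrib)
  also have "\<dots> \<le> (8 * 2 ^ s) * D ^ 3"
  proof (intro mult_right_mono)
    show "(int s + 1) ^ 3 \<le> 8 * 2 ^ s"
      using cube_le_eight_mult_power2[of s]
      by (metis (mono_tags) of_nat_1 of_nat_add of_nat_le_iff of_nat_mult of_nat_numeral of_nat_power)
  qed (use D in auto)
  finally have "2 ^ s * (4 ^ s :: int) \<le> 2 ^ s * (2 * D) ^ 3"
    by (simp add: power_mult_distrib power3_eq_cube mult_ac flip: power_mult_distrib)
  then have "(4 :: int) ^ s \<le> (2 * D) ^ 3" by simp
  then have "real_of_int (4 ^ s) \<le> real_of_int ((2 * D) ^ 3)" by (simp only: of_int_le_iff)
  then have "log 2 (4 ^ s) \<le> log 2 ((2 * real_of_int D) ^ 3)" using D by (subst log_le_cancel_iff) auto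
  moreover have "log 2 4 = (2 :: real)" using log_pow_cancel[of 2 2] by simp
  moreover have "log 2 ((2 * real_of_int D) ^ 3) = 3 * log 2 (2 * real_of_int D)" using D by (subst log_nat_power) auto
  ultimately show ?thesis by (simp add: log_nat_power)
qed

text \<open>For \<open>s < 3 * m\<close> already \<open>8 ^ m\<close> suffices. Otherwise the
  hypothesis is squared, and \<open>exp 2 * (1 + s) \<le> 4 * m * 2 powr (s / m)\<close>, raised to
  the power \<open>m\<close>, returns one of the two factors \<open>2 ^ s\<close>.\<close>

lemma support_size_aux:
  assumes m: "m \<ge> 2" and D: "D \<ge> (1 :: real)"
    and s: "s > 0 \<Longrightarrow> exp (- real m) * 2 ^ s \<le> D * sqrt (1 + real s) ^ m"
  shows "2 ^ s \<le> (4 * real m) ^ m * D\<^sup>2"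
proof (cases "s < 3 * m")
  case True
  have "(2 :: real) ^ s \<le> 2 ^ (3 * m)" using True by (intro power_increasing) auto
  also have "\<dots> = 8 ^ m" by (simp add: power_mult)
  also have "\<dots> \<le> (4 * real m) ^ m" using m by (intro power_mono) auto
  also have "\<dots> \<le> (4 * real m) ^ m * D\<^sup>2"
    using D mult_left_mono[of 1 "D\<^sup>2" "(4 * real m) ^ m"] by (simp add: one_le_power)
  finally show ?thesis .
next
  case False
  \<comment> \<open>Writing \<open>s / m\<close> as \<open>3 + t\<close> gives
    \<open>2 powr (s / m) = 8 * 2 powr t\<close>, and a linear lower bound for
    \<open>2 powr t\<close> with slope \<open>1 / 2 \<le> ln 2\<close> is enough.\<close>
  define t where "t = real s / m - 3"
  have t: "t \<ge> 0" using False m by (simp add: t_def field_simps)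
  have "(exp (1 / 2 :: real))\<^sup>2 \<le> 2\<^sup>2" using exp_le by (simp flip: exp_double)
  then have "exp (1 / 2 :: real) \<le> 2" by (rule power2_le_imp_le) simp
  then have "1 / 2 \<le> ln (2 :: real)" by (subst ln_ge_iff) auto
  then have "1 + t / 2 \<le> 1 + t * ln 2" using t mult_left_mono[of "1/2" "ln 2" t] by simp
  also have "\<dots> \<le> 2 powr t" using exp_ge_add_one_self[of "t * ln 2"] by (simp add: powr_def)
  finally have pt: "1 + t / 2 \<le> 2 powr t" .
  have "2 powr (real s / m) = 2 powr t * 8" by (simp add: t_def powr_diff)
  then have p: "8 * (1 + t / 2) \<le> 2 powr (real s / m)" using pt by simp
  have ss: "real s \<ge> 3 * real m" "real m \<ge> 2" using False m by linarith+
  have "exp 2 * (1 + real s) \<le> 9 * (1 + real s)"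
  proof (intro mult_right_mono)
    have "exp (2 :: real) = exp 1 * exp 1" by (simp flip: exp_add)
    also have "\<dots> \<le> 3 * 3" using exp_le by (intro mult_mono) auto
    finally show "exp (2 :: real) \<le> 9" by simp
  qed simp
  also have "\<dots> \<le> 4 * real m * (8 * (1 + t / 2))"
  proof -
    have "4 * real m * (8 * (1 + t / 2)) = 16 * real s - 16 * real m"
      using m by (simp add: t_def field_simps)
    moreover have "9 * (1 + real s) \<le> 16 * real s - 16 * real m" using ss by simp
    ultimately show ?thesis by simp
  qed
  also have "\<dots> \<le> 4 * real m * 2 powr (real s / m)" using p by (intro mult_left_mono) auto
  finally have e: "exp 2 * (1 + real s) \<le> 4 * real m * 2 powr (real s / m)" .
  have "2 ^ s * 2 ^ s = (exp (real m) * (exp (- real m) * 2 ^ s))\<^sup>2"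
    by (simp add: power2_eq_square flip: exp_add mult.assoc)
  also have "\<dots> \<le> (exp (real m) * (D * sqrt (1 + real s) ^ m))\<^sup>2"
    using s False m by (intro power_mono mult_left_mono) auto
  also have "\<dots> = D\<^sup>2 * (exp 2 * (1 + real s)) ^ m"
  proof -
    have "(sqrt (1 + real s) ^ m)\<^sup>2 = ((sqrt (1 + real s))\<^sup>2) ^ m"
      by (simp only: power_mult[symmetric] mult.commute)
    then have "(sqrt (1 + real s) ^ m)\<^sup>2 = (1 + real s) ^ m" by simp
    moreover have "(exp (real m))\<^sup>2 = exp (2 :: real) ^ m"
      by (simp add: mult.commute flip: exp_of_nat_mult)
    ultimately show ?thesis by (simp add: power_mult_distrib)
  qed
  also have "\<dots> \<le> D\<^sup>2 * (4 * real m * 2 powr (real s / m)) ^ m"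
    using e by (intro mult_left_mono power_mono) auto
  also have "\<dots> = 2 ^ s * ((4 * real m) ^ m * D\<^sup>2)"
  proof -
    have "(2 powr (real s / m)) ^ m = (2 :: real) ^ s"
      using m by (simp add: powr_powr flip: powr_realpow)
    then show ?thesis by (simp add: power_mult_distrib)
  qed
  finally show ?thesis by simp
qed

text \<open>The previous estimate says \<open>s \<le> 2 * log 2 ?X\<close>, and
  \<open>2 * (m + 1) \<le> 3 * m\<close> holds from \<open>m = 2\<close> on. It fails for
  \<open>m = 1\<close>, which therefore relies on the sharper interval count.\<close>

lemma support_size_bound:
  fixes D :: int
  assumes m: "m \<ge> 1" and D: "D \<ge> 1"
    and s: "s > 0 \<Longrightarrow> exp (- real m) * 2 ^ s \<le> D * sqrt (1 + real s) ^ m"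
    and s1: "m = 1 \<Longrightarrow> 2 ^ s \<le> int s * D + 1"
  shows "real (m + 1) * real s \<le> 3 * real m * log 2 ((2 * sqrt (real m)) ^ m * real_of_int D)"
proof (cases "m = 1")
  case True
  then show ?thesis using support_size_single_row[OF D s1] by simp
next
  case False
  then have m2: "m \<ge> 2" using m by simp
  let ?X = "(2 * sqrt (real m)) ^ m * real_of_int D"
  have X: "?X \<ge> 1"
  proof -
    have "sqrt (real m) \<ge> 1" using m by simp
    then have "2 * sqrt (real m) \<ge> 1" by linarith
    then have "(2 * sqrt (real m)) ^ m \<ge> 1" by (rule one_le_power)
    then have "1 * 1 \<le> ?X" using D by (intro mult_mono) auto
    then show ?thesis by simp
  qed
  have "2 ^ s \<le> (4 * real m) ^ m * (real_of_int D)\<^sup>2"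
    using support_size_aux[OF m2 _ s] D by simp
  also have "\<dots> = ?X\<^sup>2"
  proof -
    have "((2 * sqrt (real m)) ^ m)\<^sup>2 = ((2 * sqrt (real m))\<^sup>2) ^ m" by (simp only: power_mult[symmetric] mult.commute)
    then show ?thesis by (simp add: power_mult_distrib)
  qed
  finally have "log 2 (2 ^ s) \<le> log 2 (?X\<^sup>2)" using X by (subst log_le_cancel_iff) auto
  moreover have "log 2 (?X\<^sup>2) = 2 * log 2 ?X" using X by (subst log_nat_power) auto
  ultimately have "real s \<le> 2 * log 2 ?X" by (simp add: log_nat_power)
  then have "real (m + 1) * real s \<le> real (m + 1) * (2 * log 2 ?X)" by (intro mult_left_mono) auto
  also have "\<dots> \<le> 3 * real m * log 2 ?X"
  proof -
    have "log 2 ?X \<ge> 0" using X by simp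
    moreover have "2 * (m + 1) \<le> 3 * m" using m2 by simp
    then have "real (2 * (m + 1)) \<le> real (3 * m)" by (simp only: of_nat_le_iff)
    ultimately have "real (2 * (m + 1)) * log 2 ?X \<le> real (3 * m) * log 2 ?X" by (intro mult_right_mono)
    then show ?thesis by (simp add: algebra_simps)
  qed
  finally show ?thesis .
qed

section \<open>Transfer through the unimodular transformation\<close>

text \<open>Since \<open>det U\<close> squares to 1, \<open>det U\<close> times the adjugate is an
  integral inverse of \<open>U\<close>; its image over the reals is an inverse there.\<close>

lemma unimodular_mult_vec_cancel:
  fixes U :: "int mat"
  assumes U: "U \<in> carrier_mat m m" "\<bar>det U\<bar> = 1"
  shows "v \<in> carrier_vec m \<Longrightarrow> w \<in> carrier_vec m \<Longrightarrow> U *\<^sub>v v = U *\<^sub>v w \<longleftrightarrow> v = w"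
    and "x \<in> carrier_vec m \<Longrightarrow> y \<in> carrier_vec m \<Longrightarrow>
      map_mat real_of_int U *\<^sub>v x = map_mat real_of_int U *\<^sub>v y \<longleftrightarrow> x = y"
proof -
  define V where "V = det U \<cdot>\<^sub>m adj_mat U"
  have V: "V \<in> carrier_mat m m" using adj_mat(1)[OF U(1)] by (simp add: V_def)
  have "det U * det U = 1" using U(2) by (auto simp: abs_if split: if_splits)
  then have VU: "V * U = 1\<^sub>m m"
    unfolding V_def mult_smult_assoc_mat[OF adj_mat(1)[OF U(1)] U(1)] adj_mat(3)[OF U(1)]
    by (intro eq_matI) auto
  show "U *\<^sub>v v = U *\<^sub>v w \<longleftrightarrow> v = w" if "v \<in> carrier_vec m" "w \<in> carrier_vec m"
    using that assoc_mult_mat_vec[OF V U(1)] VU by (metis one_mult_mat_vec)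
  let ?U = "map_mat real_of_int U" and ?V = "map_mat real_of_int V"
  have UV': "?U \<in> carrier_mat m m" "?V \<in> carrier_mat m m" using U V by auto
  have "?V * ?U = 1\<^sub>m m"
    using of_int_hom.mat_hom_mult[OF V U(1), where ?'a = real] VU of_int_hom.mat_hom_one by metis
  then show "?U *\<^sub>v x = ?U *\<^sub>v y \<longleftrightarrow> x = y" if "x \<in> carrier_vec m" "y \<in> carrier_vec m"
    using that assoc_mult_mat_vec[OF UV'(2,1)] by (metis one_mult_mat_vec)
qed

lemma ip_feasible_unimodular:
  assumes A: "A \<in> carrier_mat m n" and b: "b \<in> carrier_vec m" and U: "U \<in> carrier_mat m m" "\<bar>det U\<bar> = 1"
  shows "ip_feasible (U * A) (U *\<^sub>v b) z \<longleftrightarrow> ip_feasible A b z"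
proof -
  have "U * A *\<^sub>v z = U *\<^sub>v b \<longleftrightarrow> A *\<^sub>v z = b" if "z \<in> carrier_vec n"
    unfolding assoc_mult_mat_vec[OF U(1) A that]
    using A b that by (intro unimodular_mult_vec_cancel(1)[OF U]) auto
  then show ?thesis using A by (auto simp: ip_feasible_def)
qed

lemma lp_feasible_unimodular:
  assumes A: "A \<in> carrier_mat m n" and b: "b \<in> carrier_vec m" and U: "U \<in> carrier_mat m m" "\<bar>det U\<bar> = 1"
  shows "lp_feasible (U * A) (U *\<^sub>v b) x \<longleftrightarrow> lp_feasible A b x"
proof -
  let ?U = "map_mat real_of_int U" and ?A = "map_mat real_of_int A"
  have UA': "?U \<in> carrier_mat m m" "?A \<in> carrier_mat m n" using U A by auto
  have "map_mat real_of_int (U * A) *\<^sub>v x = map_vec real_of_int (U *\<^sub>v b)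
      \<longleftrightarrow> ?A *\<^sub>v x = map_vec real_of_int b" if "x \<in> carrier_vec n"
    unfolding of_int_hom.mat_hom_mult[OF U(1) A] of_int_hom.mult_mat_vec_hom[OF U(1) b]
      assoc_mult_mat_vec[OF UA' that]
    using UA'(2) b that by (intro unimodular_mult_vec_cancel(2)[OF U]) auto
  then show ?thesis using A by (auto simp: lp_feasible_def)
qed

lemma abs_entry_le_max_abs_entry:
  assumes "i < dim_row M" "j < dim_col M"
  shows "\<bar>M $$ (i, j)\<bar> \<le> max_abs_entry M"
proof -
  have "{\<bar>M $$ (i, j)\<bar> | i j. i < dim_row M \<and> j < dim_col M}
      = (\<lambda>(i, j). \<bar>M $$ (i, j)\<bar>) ` ({..<dim_row M} \<times> {..<dim_col M})" by auto
  then have "finite {\<bar>M $$ (i, j)\<bar> | i j. i < dim_row M \<and> j < dim_col M}" by simp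
  then show ?thesis unfolding max_abs_entry_def by (rule Max_ge) (use assms in auto)
qed

lemma abs_det_triangular_le_max_abs_entry:
  assumes M: "M \<in> carrier_mat m m" and tri: "upper_triangular M"
  shows "\<bar>det M\<bar> \<le> max_abs_entry M ^ m"
proof -
  have "\<bar>det M\<bar> = (\<Prod>i<m. \<bar>M $$ (i, i)\<bar>)"
    unfolding det_upper_triangular[OF tri M] prod_list_diag_prod
    using M by (simp add: abs_prod atLeast0LessThan)
  also have "\<dots> \<le> (\<Prod>i<m. max_abs_entry M)"
    using M by (intro prod_mono) (auto intro: abs_entry_le_max_abs_entry)
  finally show ?thesis by simp
qed

text \<open>The bound in \<open>D\<close> is monotone, so \<open>D\<close> may be raised to
  \<open>Q\<close>. The factor in front of \<open>Q\<close> then merges with it into an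
  \<open>m\<close>-th power, and the exponent leaves the logarithm as the second factor
  \<open>m\<close> of \<open>R\<close>.\<close>

lemma proximity_bound_mono:
  fixes K D \<sigma> R :: real
  assumes m: "m \<ge> 1" and K: "K \<ge> 1" and D: "D \<ge> 1"
    and DK: "D \<le> K ^ m * (2 * log 2 (real m + 1)) powr (real m / 2)"
    and \<sigma>: "\<sigma> \<le> 3 * real m * log 2 ((2 * sqrt (real m)) ^ m * D)"
    and R_eq: "R = 3 * real m ^ 2 * log 2 (2 * sqrt (2 * real m * log 2 (real m + 1)) * K)
       * (2 * log 2 (real m + 1)) powr (real m / 2) * K ^ m"
  shows "\<sigma> * D \<le> R" and "0 < R"
proof -
  define l where "l = log 2 (real m + 1)"
  have "log 2 2 \<le> l" unfolding l_def using m by (subst log_le_cancel_iff) auto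
  then have l: "l \<ge> 1" by simp
  define Q where "Q = (2 * l) powr (real m / 2) * K ^ m"
  have DQ: "D \<le> Q" using DK by (simp add: Q_def l_def mult.commute)
  have Q1: "Q \<ge> 1" using DQ D by simp
  have "(2 * l) powr (real m / 2) = sqrt (2 * l) ^ m"
    using l by (simp add: powr_half_sqrt[symmetric] powr_powr flip: powr_realpow)
  then have "(2 * sqrt (real m)) ^ m * Q = (2 * sqrt (2 * real m * l) * K) ^ m"
    by (simp add: Q_def power_mult_distrib real_sqrt_mult mult_ac)
  then have mL: "log 2 ((2 * sqrt (real m)) ^ m * Q) = real m * log 2 (2 * sqrt (2 * real m * l) * K)"
    using m l K by (simp add: log_nat_power)
  have R: "R = 3 * real m * log 2 ((2 * sqrt (real m)) ^ m * Q) * Q"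
    unfolding R_eq mL by (simp add: Q_def l_def power2_eq_square)
  have "sqrt (real m) \<ge> 1" using m by simp
  then have "2 * sqrt (real m) > 1" by linarith
  \<comment> \<open>Strictness makes the logarithm and hence \<open>R\<close> positive, even for
    \<open>m = 1\<close> and \<open>D = 1\<close>.\<close>
  then have X: "(2 * sqrt (real m)) ^ m > 1" using m by (intro one_less_power) auto
  have "(2 * sqrt (real m)) ^ m * D \<le> (2 * sqrt (real m)) ^ m * Q"
    using DQ X by (intro mult_left_mono) auto
  moreover have XD: "(2 * sqrt (real m)) ^ m * D > 1"
    using mult_less_le_imp_less[of 1 "(2 * sqrt (real m)) ^ m" 1 D] X D by simp
  ultimately have logs: "log 2 ((2 * sqrt (real m)) ^ m * D) \<le> log 2 ((2 * sqrt (real m)) ^ m * Q)"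
    by (subst log_le_cancel_iff) linarith+
  have pos: "0 < log 2 ((2 * sqrt (real m)) ^ m * D)" using XD by simp
  then have "0 \<le> log 2 ((2 * sqrt (real m)) ^ m * Q)" using logs by linarith
  then have "0 \<le> 3 * real m * log 2 ((2 * sqrt (real m)) ^ m * Q)"
    by (rule mult_nonneg_nonneg[rotated]) simp
  moreover have "3 * real m * log 2 ((2 * sqrt (real m)) ^ m * D)
      \<le> 3 * real m * log 2 ((2 * sqrt (real m)) ^ m * Q)"
    using logs by (rule mult_left_mono) simp
  moreover have "0 \<le> D" using D by simp
  ultimately have le: "3 * real m * log 2 ((2 * sqrt (real m)) ^ m * D) * D \<le> R"
    unfolding R using DQ mult_mono by blast
  have "\<sigma> * D \<le> 3 * real m * log 2 ((2 * sqrt (real m)) ^ m * D) * D"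
    using \<sigma> D by (intro mult_right_mono) auto
  then show "\<sigma> * D \<le> R" using le by (rule order_trans)
  have "0 < 3 * real m * log 2 ((2 * sqrt (real m)) ^ m * D) * D" using pos m D by simp
  then show "0 < R" using le by (rule less_le_trans)
qed

theorem theorem2:
  fixes A :: "int mat" and b c :: "int vec" and U :: "int mat" and J :: "nat set" and m n :: nat
  assumes A: "A \<in> carrier_mat m n" and b: "b \<in> carrier_vec m" and c: "c \<in> carrier_vec n"
    and m: "m \<ge> 1"
    and rank: "vec_space.rank m (map_mat real_of_int A) = m"
    and feas: "\<exists>z. ip_feasible A b z"
    and bdd: "\<exists>M. \<forall>z. ip_feasible A b z \<longrightarrow> c \<bullet> z \<le> M"
    and J: "J \<subseteq> {..<n}" "card J = m"
    and Delta: "real_of_int (Delta A)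
        \<le> \<bar>real_of_int (det (submatrix A UNIV J))\<bar> * (2 * log 2 (real m + 1)) powr (real m / 2)"
    and U: "U \<in> carrier_mat m m" "\<bar>det U\<bar> = 1"
    and tri: "upper_triangular (U * submatrix A UNIV J)"
    and xopt: "lp_vertex (U * A) (U *\<^sub>v b) xs" "lp_optimal (U * A) (U *\<^sub>v b) c xs"
  shows "\<exists>zs. ip_optimal (U * A) (U *\<^sub>v b) c zs \<and>
     (\<Sum>i<n. \<bar>real_of_int (zs $ i) - xs $ i\<bar>)
       < 3 * real m ^ 2
         * log 2 (2 * sqrt (2 * real m * log 2 (real m + 1)) * real_of_int (max_abs_entry (U * submatrix A UNIV J)))
         * (2 * log 2 (real m + 1)) powr (real m / 2)
         * real_of_int (max_abs_entry (U * submatrix A UNIV J)) ^ m"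
proof -
  let ?B = "submatrix A UNIV J"
  define K where "K = max_abs_entry (U * ?B)"
  have mn: "m \<le> n" using J card_mono[of "{..<n}" J] by simp
  obtain f0 where f0: "\<And>k. k < m \<Longrightarrow> f0 k < n" "det (col_select A f0) \<noteq> 0"
    using full_row_rank_nonzero_minor[OF A rank] by blast
  then have ex: "\<exists>f. (\<forall>k<m. f k < n) \<and> det (col_select A f) \<noteq> 0" by blast
  have D0: "Delta A > 0" using abs_det_col_select_le_Delta[OF A mn, of f0] f0 by force
  \<comment> \<open>The minor at \<open>J\<close> is only nearly maximal, while coordinates bounded
    by 1 require an exactly maximal one; \<open>J'\<close> provides it.\<close>
  obtain J' where J': "J' \<subseteq> {..<n}" "card J' = m" "\<bar>det (submatrix A UNIV J')\<bar> = Delta A"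
    using Delta_attained[OF A mn] by blast
  have f: "\<And>k. k < m \<Longrightarrow> pick J' k < n" "\<bar>det (col_select A (pick J'))\<bar> = Delta A"
    using J' bij_betw_pick[of J' m] finite_subset[OF J'(1)] submatrix_eq_col_select[OF A J'(1,2)]
    by (auto simp: bij_betw_def)
  obtain z where z: "ip_optimal A b c z"
    and dist: "\<And>Y Z. Y \<subseteq> {j. j < n \<and> z $ j \<noteq> 0} \<Longrightarrow> Z \<subseteq> {j. j < n \<and> z $ j \<noteq> 0} \<Longrightarrow>
      (\<And>i. i < m \<Longrightarrow> (\<Sum>j\<in>Y. A $$ (i, j)) = (\<Sum>j\<in>Z. A $$ (i, j))) \<Longrightarrow> Y = Z"
    using sparse_ip_optimum[OF A b c feas bdd] by blast
  define S where "S = {j. j < n \<and> z $ j \<noteq> 0}"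
  have S: "S \<subseteq> {..<n}" by (auto simp: S_def)
  note dist = dist[folded S_def]
  have size: "real (m + 1) * real (card S) \<le> 3 * real m * log 2 ((2 * sqrt (real m)) ^ m * real_of_int (Delta A))"
  proof (rule support_size_bound[OF m])
    show "Delta A \<ge> 1" using D0 by simp
    show "exp (- real m) * 2 ^ card S \<le> real_of_int (Delta A) * sqrt (1 + real (card S)) ^ m"
      if "card S > 0"
      by (rule distinct_column_sums_bound[where f = "pick J'", OF A mn f D0 S that dist])
    show "2 ^ card S \<le> int (card S) * Delta A + 1" if m1: "m = 1"
      by (rule column_sum_single_row_bound[OF A[unfolded m1] mn[unfolded m1] S dist[unfolded m1]])
  qed
  have Bc: "?B \<in> carrier_mat m m" unfolding submatrix_eq_col_select[OF A J] using A by simp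
  have UB: "U * ?B \<in> carrier_mat m m" using U Bc by simp
  have detUB: "\<bar>det (U * ?B)\<bar> = \<bar>det ?B\<bar>" using U by (simp add: det_mult[OF U(1) Bc] abs_mult)
  \<comment> \<open>A zero determinant would force \<open>Delta A \<le> 0\<close>. Hence the
    diagonal of the triangular \<open>U * ?B\<close> has no zero, and
    \<open>K \<ge> 1\<close>.\<close>
  have "det ?B \<noteq> 0" using Delta D0 by auto
  then have "det (U * ?B) \<noteq> 0" using detUB by simp
  then have "(U * ?B) $$ (0, 0) \<noteq> 0"
    unfolding det_upper_triangular[OF tri UB] prod_list_diag_prod using UB m by auto
  moreover have "\<bar>(U * ?B) $$ (0, 0)\<bar> \<le> K"
    unfolding K_def using UB m by (intro abs_entry_le_max_abs_entry) auto
  ultimately have K1: "K \<ge> 1" by linarith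
  have "\<bar>det ?B\<bar> \<le> K ^ m"
    using abs_det_triangular_le_max_abs_entry[OF UB tri] detUB by (simp add: K_def)
  then have "real_of_int \<bar>det ?B\<bar> \<le> real_of_int (K ^ m)" by (simp only: of_int_le_iff)
  then have "\<bar>real_of_int (det ?B)\<bar> * (2 * log 2 (real m + 1)) powr (real m / 2)
      \<le> real_of_int K ^ m * (2 * log 2 (real m + 1)) powr (real m / 2)"
    by (intro mult_right_mono) auto
  with Delta have DK: "real_of_int (Delta A) \<le> real_of_int K ^ m * (2 * log 2 (real m + 1)) powr (real m / 2)"
    by (rule order_trans)
  have KD: "real_of_int K \<ge> 1" "real_of_int (Delta A) \<ge> 1" using K1 D0 by auto
  note bound = proximity_bound_mono[OF m KD DK size refl]
  \<comment> \<open>With equal feasible sets, vertices and optima of the transformed and the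
    original programs coincide as well.\<close>
  have feas_eq: "ip_feasible (U * A) (U *\<^sub>v b) = ip_feasible A b"
    "lp_feasible (U * A) (U *\<^sub>v b) = lp_feasible A b"
    using ip_feasible_unimodular[OF A b U] lp_feasible_unimodular[OF A b U] by auto
  have x: "lp_vertex A b xs" "lp_optimal A b c xs"
    using xopt by (auto simp: lp_vertex_def lp_optimal_def feas_eq)
  obtain y where y: "ip_optimal A b c y" and close: "(\<Sum>j<n. \<bar>of_int (y $ j) - xs $ j\<bar>) = 0 \<or>
    (\<Sum>j<n. \<bar>of_int (y $ j) - xs $ j\<bar>) < real (card S) * (real (m + 1) * of_int (Delta A))"
    using l1_distance_bound[OF A mn b c ex D0 x z, folded S_def] by blast
  show ?thesis
  proof (intro exI[of _ y] conjI)
    show "ip_optimal (U * A) (U *\<^sub>v b) c y" using y by (simp add: ip_optimal_def feas_eq)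
    have comm: "real (card S) * (real (m + 1) * real_of_int (Delta A))
      = real (m + 1) * real (card S) * real_of_int (Delta A)" by simp
    show "(\<Sum>i<n. \<bar>real_of_int (y $ i) - xs $ i\<bar>)
       < 3 * real m ^ 2
         * log 2 (2 * sqrt (2 * real m * log 2 (real m + 1)) * real_of_int (max_abs_entry (U * ?B)))
         * (2 * log 2 (real m + 1)) powr (real m / 2)
         * real_of_int (max_abs_entry (U * ?B)) ^ m"
      \<comment> \<open>Positivity of the right side settles distance zero; otherwise the strict
        inequality is chained with the first part of \<open>bound\<close>.\<close>
      using close bound unfolding comm K_def by linarith
  qed
qed

end
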